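(* Let $\mathcal{H}$ be a complex separable Hilbert space and let $T\in\mathcal{L}(\mathcal{H})$ be an essentially normal operator. Then $T$ has a proper Følner sequence.
   Context: $\mathcal{L}(\mathcal{H})$ denotes the C*-algebra of bounded linear operators on $\mathcal{H}$. An operator $T\in\mathcal{L}(\mathcal{H})$ is called essentially normal if its self-commutator $[T,T^*]=TT^*-T^*T$ is a compact operator. $\|\cdot\|_2$ denotes the Hilbert–Schmidt norm (the Schatten–von Neumann norm with $p=2$). A Følner sequence for an operator $T\in\mathcal{L}(\mathcal{H})$ is a sequence $\{P_n\}_{n\in\mathbb{N}}$ of non-zero finite rank orthogonal projections on $\mathcal{H}$ such that $$\lim_{n\to\infty}\frac{\|TP_n-P_nT\|_2}{\|P_n\|_2}=0.$$ It is called a proper Følner sequence for $T$ if, in addition, it is increasing and converges strongly to the identity $\mathbf{1}$. *)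

theory Defs
  imports "HOL-Analysis.Analysis"
begin

class complex_vector = real_vector +
  fixes scaleC :: "complex \<Rightarrow> 'a \<Rightarrow> 'a"  (infixr "*\<^sub>C" 75)
  assumes scaleC_add_right: "c *\<^sub>C (x + y) = c *\<^sub>C x + c *\<^sub>C y"
    and scaleC_add_left: "(c + d) *\<^sub>C x = c *\<^sub>C x + d *\<^sub>C x"
    and scaleC_scaleC [simp]: "c *\<^sub>C d *\<^sub>C x = (c * d) *\<^sub>C x"
    and scaleC_one [simp]: "1 *\<^sub>C x = x"
    and scaleR_scaleC: "r *\<^sub>R x = complex_of_real r *\<^sub>C x"

global_interpretation complex_vector:
  vector_space "scaleC :: complex \<Rightarrow> 'a \<Rightarrow> 'a :: complex_vector"
  defines cspan = complex_vector.span
  by unfold_locales (simp_all add: scaleC_add_right scaleC_add_left)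

text \<open>
  The real inner product underlying a complex inner product is its real part. Building on
  \<^class>\<open>real_inner\<close> provides norm and topology with
  \<open>norm x = sqrt (inner x x) = sqrt (Re (cinner x x))\<close>, and positive definiteness of
  \<open>cinner\<close>, since \<open>cinner x x\<close> is real by Hermitian symmetry.
  The form is linear in its first argument.
\<close>

class complex_inner = complex_vector + real_inner +
  fixes cinner :: "'a \<Rightarrow> 'a \<Rightarrow> complex"
  assumes cinner_commute: "cinner x y = cnj (cinner y x)"
    and cinner_add_left: "cinner (x + y) z = cinner x z + cinner y z"
    and cinner_scaleC_left: "cinner (c *\<^sub>C x) y = c * cinner x y"
    and inner_eq_Re_cinner: "inner x y = Re (cinner x y)"

class complex_hilbert_space = complex_inner + complete_space

definition bounded_clinear :: "('a::complex_inner \<Rightarrow> 'a) \<Rightarrow> bool"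
  where "bounded_clinear A \<longleftrightarrow> bounded_linear A \<and> (\<forall>c x. A (c *\<^sub>C x) = c *\<^sub>C A x)"

text \<open>As for \<^const>\<open>adjoint\<close> in the library; for a bounded operator on a Hilbert space the
  function described exists and is unique.\<close>

definition cadjoint :: "('a::complex_inner \<Rightarrow> 'a) \<Rightarrow> 'a \<Rightarrow> 'a"
  where "cadjoint A = (SOME B. \<forall>x y. cinner (A x) y = cinner x (B y))"

definition compact_operator :: "('a::complex_inner \<Rightarrow> 'a) \<Rightarrow> bool"
  where "compact_operator A \<longleftrightarrow> bounded_clinear A \<and> compact (closure (A ` cball 0 1))"

definition essentially_normal :: "('a::complex_inner \<Rightarrow> 'a) \<Rightarrow> bool"
  where "essentially_normal A \<longleftrightarrow>
    compact_operator (\<lambda>x. A (cadjoint A x) - cadjoint A (A x))"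

definition orthonormal_basis :: "'a::complex_inner set \<Rightarrow> bool"
  where "orthonormal_basis B \<longleftrightarrow>
    (\<forall>b\<in>B. \<forall>b'\<in>B. cinner b b' = (if b = b' then 1 else 0)) \<and> closure (cspan B) = UNIV"

text \<open>
  The Hilbert-Schmidt norm \<open>(\<Sum>e. (norm (A e))\<^sup>2)\<^sup>1\<^sup>/\<^sup>2\<close>, whose value does not depend on
  the orthonormal basis. The value is meaningful only for Hilbert-Schmidt operators, in
  particular for all bounded operators of finite rank; if the series diverges,
  \<^const>\<open>infsum\<close> yields \<open>0\<close>.
\<close>

definition hs_norm :: "('a::complex_hilbert_space \<Rightarrow> 'a) \<Rightarrow> real"
  where "hs_norm A =
    (let B = (SOME B. orthonormal_basis B) in sqrt (\<Sum>\<^sub>\<infinity>e\<in>B. (norm (A e))\<^sup>2))"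

definition finite_rank :: "('a::complex_inner \<Rightarrow> 'a) \<Rightarrow> bool"
  where "finite_rank A \<longleftrightarrow> (\<exists>B. finite B \<and> range A \<subseteq> cspan B)"

definition orthogonal_projection :: "('a::complex_inner \<Rightarrow> 'a) \<Rightarrow> bool"
  where "orthogonal_projection P \<longleftrightarrow> bounded_clinear P \<and> P \<circ> P = P \<and> cadjoint P = P"

definition folner_sequence ::
    "('a::complex_hilbert_space \<Rightarrow> 'a) \<Rightarrow> (nat \<Rightarrow> 'a \<Rightarrow> 'a) \<Rightarrow> bool"
  where "folner_sequence T P \<longleftrightarrow>
    (\<forall>n. orthogonal_projection (P n) \<and> finite_rank (P n) \<and> P n \<noteq> (\<lambda>x. 0)) \<and>
    (\<lambda>n. hs_norm (\<lambda>x. T (P n x) - P n (T x)) / hs_norm (P n)) \<longlonglongrightarrow> 0"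

text \<open>Projections are ordered by inclusion of their ranges.\<close>

definition proper_folner_sequence ::
    "('a::complex_hilbert_space \<Rightarrow> 'a) \<Rightarrow> (nat \<Rightarrow> 'a \<Rightarrow> 'a) \<Rightarrow> bool"
  where "proper_folner_sequence T P \<longleftrightarrow>
    folner_sequence T P \<and>
    (\<forall>m n. m \<le> n \<longrightarrow> range (P m) \<subseteq> range (P n)) \<and>
    (\<forall>x. (\<lambda>n. P n x) \<longlonglongrightarrow> x)"

end

theory Submission
  imports Defs
begin

text \<open>
  If the space has finite dimension, the constant sequence of identity operators is a proper Folner
  sequence, as all commutators vanish. In infinite dimension the main point is that an essentially
  normal operator \<open>T\<close> has joint approximate eigenvectors far away from every finite-dimensional
  subspace: there are a complex number \<open>\<mu>\<close> and a weakly null sequence of unit vectors \<open>x\<^sub>n\<close> such that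
  both \<open>T x\<^sub>n - \<mu> x\<^sub>n\<close> and \<open>T\<^sup>* x\<^sub>n - cnj \<mu> x\<^sub>n\<close> tend to zero
  (\<open>essentially_normal_approximate_eigenvectors\<close>).

  The sequence \<open>x\<^sub>n\<close> is found without spectral theory. Write \<open>T = A + \<i> B\<close> with \<open>A\<close> and \<open>B\<close> self-adjoint.
  Maximising the asymptotic value of \<open>inner (A x\<^sub>n) x\<^sub>n\<close> over weakly null sequences of unit vectors
  gives a real number \<open>\<alpha>\<close> and a sequence with \<open>A x\<^sub>n - \<alpha> x\<^sub>n\<close> tending to zero. The bounded weakly null
  sequences with this property form a space that is invariant under \<open>B\<close>, because \<open>A B - B A\<close> is a
  multiple of the self-commutator of \<open>T\<close>, hence compact, and compact operators map weakly null
  sequences to norm null sequences. The same maximisation for \<open>B\<close> on this space gives \<open>\<beta>\<close>, and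
  \<open>\<mu> = \<alpha> + \<i> \<beta>\<close>. Both maximisations are instances of \<open>exists_approximate_eigenvalue\<close>.

  Now let \<open>E\<close> be a finite orthonormal set. Projecting the \<open>x\<^sub>n\<close> away from \<open>E\<close>, one can adjoin to \<open>E\<close> any
  number \<open>N\<close> of orthonormal joint approximate eigenvectors, as good as desired. The Hilbert-Schmidt
  norm of the commutator of \<open>T\<close> with the projection onto the span of the enlarged set is then bounded
  independently of \<open>N\<close>, whereas that of the projection itself is at least \<open>sqrt N\<close>
  (\<open>exists_folner_extension\<close>). Alternating such extensions with the adjunction of the members of a dense
  sequence produces an increasing sequence of finite orthonormal sets, whose projections form a
  proper Folner sequence (\<open>proper_folner_sequence_proj\<close>).
\<close>

section \<open>Complex inner products\<close>

lemma scaleC_diff_right: "c *\<^sub>C (x - y) = c *\<^sub>C x - c *\<^sub>C (y::'a::complex_vector)"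
  by (rule complex_vector.scale_right_diff_distrib)

lemma cinner_zero_left [simp]: "cinner 0 (y::'a::complex_inner) = 0"
  using cinner_scaleC_left[of 0 0 y] by simp

lemma cinner_zero_right [simp]: "cinner (y::'a::complex_inner) 0 = 0"
  by (subst cinner_commute) simp

lemma cinner_minus_left: "cinner (- x) (y::'a::complex_inner) = - cinner x y"
  using cinner_scaleC_left[of "-1" x y] by simp

lemma cinner_diff_left: "cinner (x - z) (y::'a::complex_inner) = cinner x y - cinner z y"
  using cinner_add_left[of x "-z" y] by (simp add: cinner_minus_left)

lemma cinner_add_right: "cinner (x::'a::complex_inner) (y + z) = cinner x y + cinner x z"
  by (subst (1 2 3) cinner_commute) (simp add: cinner_add_left)

lemma cinner_scaleC_right: "cinner (x::'a::complex_inner) (c *\<^sub>C y) = cnj c * cinner x y"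
  by (subst (1 2) cinner_commute) (simp add: cinner_scaleC_left)

lemma cinner_diff_right: "cinner (y::'a::complex_inner) (x - z) = cinner y x - cinner y z"
  by (subst (1 2 3) cinner_commute) (simp add: cinner_diff_left)

lemma cinner_sum_left: "cinner (sum f A) (y::'a::complex_inner) = (\<Sum>i\<in>A. cinner (f i) y)"
  by (induction A rule: infinite_finite_induct) (simp_all add: cinner_add_left)

lemma cinner_self: "cinner x x = complex_of_real ((norm (x::'a::complex_inner))\<^sup>2)"
proof (rule complex_eqI)
  show "Re (cinner x x) = Re (complex_of_real ((norm x)\<^sup>2))"
    using inner_eq_Re_cinner[of x x] by (simp add: power2_norm_eq_inner)
  have "Im (cinner x x) = - Im (cinner x x)"
    by (subst cinner_commute) simp
  then show "Im (cinner x x) = Im (complex_of_real ((norm x)\<^sup>2))"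
    by simp
qed

lemma Im_cinner: "Im (cinner x y) = inner x (\<i> *\<^sub>C (y::'a::complex_inner))"
  by (simp add: inner_eq_Re_cinner cinner_scaleC_right)

lemma norm_scaleC: "norm (c *\<^sub>C (x::'a::complex_inner)) = cmod c * norm x"
proof -
  have "complex_of_real ((norm (c *\<^sub>C x))\<^sup>2) = c * cnj c * complex_of_real ((norm x)\<^sup>2)"
    by (simp only: cinner_self[symmetric] cinner_scaleC_left cinner_scaleC_right mult_ac)
  also have "\<dots> = complex_of_real ((cmod c * norm x)\<^sup>2)"
    by (simp only: complex_norm_square[symmetric] of_real_mult[symmetric] power_mult_distrib)
  finally have "(norm (c *\<^sub>C x))\<^sup>2 = (cmod c * norm x)\<^sup>2"
    using of_real_eq_iff by blast
  then show ?thesis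
    by (simp add: power2_eq_iff_nonneg)
qed

lemma norm_cinner_le: "cmod (cinner x y) \<le> norm x * norm (y::'a::complex_inner)"
proof (cases "cinner x y = 0")
  case False
  define u where "u = cnj (cinner x y) / complex_of_real (cmod (cinner x y))"
  have u: "cmod u = 1" "u * cinner x y = complex_of_real (cmod (cinner x y))"
    using False by (auto simp: u_def norm_divide field_simps complex_norm_square[symmetric] power2_eq_square[symmetric]
        simp flip: of_real_power)
  have "cmod (cinner x y) = inner (u *\<^sub>C x) y"
    by (simp add: inner_eq_Re_cinner cinner_scaleC_left u)
  also have "\<dots> \<le> norm (u *\<^sub>C x) * norm y"
    by (rule norm_cauchy_schwarz)
  finally show ?thesis
    by (simp add: norm_scaleC u)
qed simp

lemma bounded_clinear_simps:
  assumes "bounded_clinear A"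
  shows "A (x + y) = A x + A y" "A (x - y) = A x - A y" "A (c *\<^sub>C x) = c *\<^sub>C A x"
    "A (r *\<^sub>R x) = r *\<^sub>R A x" "A 0 = 0" "A (sum f I) = (\<Sum>i\<in>I. A (f i))"
  using assms unfolding bounded_clinear_def
  by (auto simp: linear_simps bounded_linear.linear linear_sum)

section \<open>The adjoint\<close>

text \<open>The representing vector minimises \<open>x \<mapsto> \<parallel>x\<parallel>\<^sup>2 - 2 \<phi>(x)\<close>; by the parallelogram identity a
  minimising sequence is Cauchy.\<close>

lemma riesz_representation:
  fixes \<phi> :: "'a::{real_inner, complete_space} \<Rightarrow> real"
  assumes "bounded_linear \<phi>"
  shows "\<exists>z. \<forall>x. \<phi> x = inner x z"
proof -
  interpret bounded_linear \<phi> by fact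
  define J where "J = (\<lambda>x. (norm x)\<^sup>2 - 2 * \<phi> x)"
  obtain K where K: "\<And>x. \<bar>\<phi> x\<bar> \<le> norm x * K"
    using bounded by auto
  have "J x \<ge> - K\<^sup>2" for x
  proof -
    have "J x + K\<^sup>2 \<ge> (norm x - K)\<^sup>2"
      using K[of x] by (simp add: J_def power2_eq_square algebra_simps abs_le_iff)
    then show ?thesis
      by (smt (verit) zero_le_power2)
  qed
  then have bdd: "bdd_below (range J)"
    by (auto intro!: bdd_belowI)
  define m where "m = Inf (range J)"
  have m: "m \<le> J x" for x
    unfolding m_def by (rule cInf_lower[OF _ bdd]) simp
  have "\<exists>x. J x < m + 1 / Suc n" for n
    using cInf_lessD[of "range J" "m + 1 / Suc n"] by (auto simp: m_def)
  then obtain x where x: "\<And>n. J (x n) < m + 1 / Suc n"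
    by metis
  have par: "(norm (u - v))\<^sup>2 = 2 * J u + 2 * J v - 4 * J ((1/2) *\<^sub>R (u + v))" for u v
    by (simp add: J_def power2_norm_eq_inner inner_diff_left inner_diff_right inner_add_left
        inner_add_right scaleR add algebra_simps inner_commute)
  have dist: "(norm (x i - x j))\<^sup>2 < 4 / Suc N" if "i \<ge> N" "j \<ge> N" for i j N
  proof -
    have "1 / real (Suc i) \<le> 1 / Suc N" "1 / real (Suc j) \<le> 1 / Suc N"
      using that by (auto intro!: divide_left_mono)
    then show ?thesis
      using x[of i] x[of j] m[of "(1/2) *\<^sub>R (x i + x j)"] by (simp only: par)
  qed
  have "Cauchy x"
  proof (rule metric_CauchyI)
    fix e :: real assume "e > 0"
    obtain N where "inverse (real (Suc N)) < e\<^sup>2 / 4"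
      using reals_Archimedean[of "e\<^sup>2 / 4"] \<open>e > 0\<close> by auto
    then have N: "4 / real (Suc N) < e\<^sup>2"
      by (simp add: inverse_eq_divide)
    show "\<exists>N. \<forall>i\<ge>N. \<forall>j\<ge>N. dist (x i) (x j) < e"
    proof (intro exI allI impI)
      fix i j assume "i \<ge> N" "j \<ge> N"
      then have "(norm (x i - x j))\<^sup>2 < e\<^sup>2"
        using dist[of N i j] N by linarith
      then show "dist (x i) (x j) < e"
        using \<open>e > 0\<close> by (simp add: dist_norm power2_less_imp_less)
    qed
  qed
  then obtain z where z: "x \<longlonglongrightarrow> z"
    using Cauchy_convergent_iff convergent_def by blast
  have "(\<lambda>n. J (x n)) \<longlonglongrightarrow> J z"
    unfolding J_def by (intro tendsto_intros tendsto z)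
  moreover have "(\<lambda>n. J (x n)) \<longlonglongrightarrow> m"
  proof (rule tendsto_sandwich[where f = "\<lambda>_. m" and h = "\<lambda>n. m + 1 / Suc n"])
    show "(\<lambda>n. m + 1 / Suc n) \<longlonglongrightarrow> m"
      using tendsto_add[OF tendsto_const LIMSEQ_Suc[OF lim_1_over_n], of m] by simp
    show "\<forall>\<^sub>F n in sequentially. J (x n) \<le> m + 1 / Suc n"
      using x by (intro always_eventually allI less_imp_le)
  qed (use m in auto)
  ultimately have Jz: "J z = m"
    using LIMSEQ_unique by blast
  have "\<phi> y = inner y z" for y
  proof -
    define q where "q = inner y z - \<phi> y"
    have ineq: "0 \<le> t * (2 * q) + t\<^sup>2 * (norm y)\<^sup>2" for t
    proof -
      have "(norm (z + t *\<^sub>R y))\<^sup>2 = (norm z)\<^sup>2 + t * (2 * inner y z) + t\<^sup>2 * (norm y)\<^sup>2"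
        unfolding power2_norm_eq_inner
        by (simp add: inner_add_left inner_add_right inner_commute power2_eq_square)
      then show ?thesis
        using m[of "z + t *\<^sub>R y"] unfolding Jz[symmetric]
        by (simp add: J_def q_def add scaleR algebra_simps)
    qed
    define s where "s = (norm y)\<^sup>2 + 1"
    have s: "s > 0" "(norm y)\<^sup>2 \<le> s"
      by (simp_all add: s_def add_pos_nonneg add_nonneg_pos)
    \<comment> \<open>The parameter \<open>- q / s\<close> minimises the right-hand side up to the gap between \<open>s\<close> and
      \<open>(norm y)\<^sup>2\<close>, which keeps the denominator positive.\<close>
    have "0 \<le> (- q / s) * (2 * q) + (- q / s)\<^sup>2 * (norm y)\<^sup>2"
      by (rule ineq)
    also have "\<dots> \<le> (- q / s) * (2 * q) + (- q / s)\<^sup>2 * s"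
      by (intro add_left_mono mult_left_mono s) auto
    also have "\<dots> = - (q\<^sup>2 / s)"
      using s by (simp add: power2_eq_square field_simps)
    finally have "q\<^sup>2 \<le> 0"
      using s by (simp add: divide_le_0_iff)
    then show ?thesis
      by (simp add: q_def)
  qed
  then show ?thesis
    by blast
qed

text \<open>An adjoint for the real inner product is one for the complex inner product.\<close>

lemma cinner_adjoint_of_inner:
  fixes A :: "'a::complex_inner \<Rightarrow> 'a"
  assumes "bounded_clinear A" "\<And>x y. inner (A x) y = inner x (B y)"
  shows "cinner (A x) y = cinner x (B y)"
proof (rule complex_eqI)
  have Im: "Im (cinner u v) = inner ((- \<i>) *\<^sub>C u) v" for u v :: 'a
    unfolding inner_eq_Re_cinner cinner_scaleC_left by simp
  show "Im (cinner (A x) y) = Im (cinner x (B y))"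
    unfolding Im assms(2)[symmetric] bounded_clinear_simps[OF assms(1)] ..
qed (simp add: inner_eq_Re_cinner[symmetric] assms(2))

lemma cinner_cadjoint:
  fixes A :: "'a::complex_hilbert_space \<Rightarrow> 'a"
  assumes "bounded_clinear A"
  shows "cinner (A x) y = cinner x (cadjoint A y)"
proof -
  have "\<exists>z. \<forall>x. inner (A x) y = inner x z" for y
    using assms unfolding bounded_clinear_def
    by (intro riesz_representation bounded_linear_compose[OF bounded_linear_inner_left]) auto
  then obtain B where "\<And>x y. inner (A x) y = inner x (B y)"
    by metis
  then have "\<exists>B. \<forall>x y. cinner (A x) y = cinner x (B y)"
    using cinner_adjoint_of_inner[OF assms] by blast
  then show ?thesis
    unfolding cadjoint_def by (rule someI2_ex) blast
qed

lemma cinner_eqI: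
  fixes y z :: "'a::complex_inner"
  assumes "\<And>x. cinner x y = cinner x z"
  shows "y = z"
proof -
  have "cinner (y - z) (y - z) = 0"
    using assms by (simp add: cinner_diff_right)
  then show ?thesis
    by (simp add: cinner_self)
qed

lemma cadjoint_eqI:
  fixes A :: "'a::complex_inner \<Rightarrow> 'a"
  assumes "\<And>x y. cinner (A x) y = cinner x (B y)"
  shows "cadjoint A = B"
  unfolding cadjoint_def
proof (rule some_equality)
  fix C assume C: "\<forall>x y. cinner (A x) y = cinner x (C y)"
  show "C = B"
  proof
    fix y
    show "C y = B y"
      by (rule cinner_eqI) (use C assms in metis)
  qed
qed (use assms in blast)

lemma bounded_clinear_cadjoint:
  fixes A :: "'a::complex_hilbert_space \<Rightarrow> 'a"
  assumes A: "bounded_clinear A"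
  shows "bounded_clinear (cadjoint A)"
proof -
  note adj = cinner_cadjoint[OF A, symmetric]
  have add: "cadjoint A (x + y) = cadjoint A x + cadjoint A y" for x y
    by (rule cinner_eqI) (simp add: cinner_add_right adj)
  have scale: "cadjoint A (c *\<^sub>C x) = c *\<^sub>C cadjoint A x" for c x
    by (rule cinner_eqI) (simp add: cinner_scaleC_right adj)
  obtain K where K: "\<And>x. norm (A x) \<le> norm x * K"
    using A unfolding bounded_clinear_def by (metis bounded_linear.bounded)
  have "norm (cadjoint A y) \<le> norm y * K" for y
  proof (cases "cadjoint A y = 0")
    case True
    have "0 \<le> norm y * K"
      using K[of y] norm_ge_zero order_trans by blast
    then show ?thesis
      using True by simp
  next
    case False
    have "norm (cadjoint A y) * norm (cadjoint A y) = cmod (cinner (A (cadjoint A y)) y)"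
      unfolding cinner_cadjoint[OF A] cinner_self norm_of_real by (simp add: power2_eq_square)
    also have "\<dots> \<le> norm (A (cadjoint A y)) * norm y"
      by (rule norm_cinner_le)
    also have "\<dots> \<le> norm (cadjoint A y) * K * norm y"
      by (intro mult_right_mono K) simp
    finally show ?thesis
      using False by (simp add: mult_ac)
  qed
  then have "bounded_linear (cadjoint A)"
    by (intro bounded_linear_intro[where K = K]) (auto simp: add scaleR_scaleC scale)
  then show ?thesis
    unfolding bounded_clinear_def using scale by blast
qed

section \<open>Finite orthonormal sets and their projections\<close>

text \<open>Orthonormality of a set of vectors, without any completeness.\<close>

definition orthonormal :: "'a::complex_inner set \<Rightarrow> bool"
  where "orthonormal E \<longleftrightarrow> (\<forall>b\<in>E. \<forall>b'\<in>E. cinner b b' = (if b = b' then 1 else 0))"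

text \<open>For a finite orthonormal set this is the orthogonal projection onto its span.\<close>

definition proj :: "'a::complex_inner set \<Rightarrow> 'a \<Rightarrow> 'a"
  where "proj E x = (\<Sum>e\<in>E. cinner x e *\<^sub>C e)"

lemma orthonormalD: "orthonormal E \<Longrightarrow> e \<in> E \<Longrightarrow> f \<in> E \<Longrightarrow> cinner e f = (if e = f then 1 else 0)"
  by (simp add: orthonormal_def)

lemma orthonormal_norm: "orthonormal E \<Longrightarrow> e \<in> E \<Longrightarrow> norm e = 1"
  using orthonormalD[of E e e] by (simp add: cinner_self power2_eq_1_iff flip: of_real_power) (smt (verit) norm_ge_zero)

lemma orthonormal_subset: "orthonormal E \<Longrightarrow> F \<subseteq> E \<Longrightarrow> orthonormal F"
  unfolding orthonormal_def by blast

lemma orthonormal_insert: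
  assumes "orthonormal E" "norm u = 1" "\<And>e. e \<in> E \<Longrightarrow> cinner u e = 0"
  shows "orthonormal (insert u E)"
proof -
  have "cinner e u = 0" if "e \<in> E" for e
    by (subst cinner_commute) (simp add: assms(3) that)
  moreover have "cinner u u = 1"
    by (simp add: cinner_self assms(2))
  ultimately show ?thesis
    using assms(1,3) unfolding orthonormal_def by (metis insert_iff)
qed

lemma proj_in_span: "proj E x \<in> cspan E"
  unfolding proj_def
  by (intro complex_vector.span_sum complex_vector.span_scale complex_vector.span_base)

context
  fixes E :: "'a::complex_inner set"
  assumes fin: "finite E" and orth: "orthonormal E"
begin

lemma cinner_proj: "e \<in> E \<Longrightarrow> cinner (proj E x) e = cinner x e"
  using fin
  by (simp add: proj_def cinner_sum_left cinner_scaleC_left orthonormalD[OF orth]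
      if_distrib[of "\<lambda>z. _ * z"] cong: if_cong)

lemma cinner_diff_proj_span: "v \<in> cspan E \<Longrightarrow> cinner (x - proj E x) v = 0"
proof (induction rule: complex_vector.span_induct_alt)
  case (step c v w)
  then show ?case
    by (simp add: cinner_add_right cinner_scaleC_right cinner_diff_left cinner_proj)
qed simp

lemma proj_pythagoras: "v \<in> cspan E \<Longrightarrow> (norm (x - v))\<^sup>2 = (norm (x - proj E x))\<^sup>2 + (norm (proj E x - v))\<^sup>2"
proof -
  assume "v \<in> cspan E"
  then have "inner (x - proj E x) (proj E x - v) = 0"
    using cinner_diff_proj_span[OF complex_vector.span_diff[OF proj_in_span]]
    by (simp add: inner_eq_Re_cinner)
  then have "(norm ((x - proj E x) + (proj E x - v)))\<^sup>2 = (norm (x - proj E x))\<^sup>2 + (norm (proj E x - v))\<^sup>2"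
    by (intro norm_add_Pythagorean) (simp add: orthogonal_def)
  then show ?thesis
    by simp
qed

lemma proj_best_approx: "v \<in> cspan E \<Longrightarrow> norm (x - proj E x) \<le> norm (x - v)"
  by (rule power2_le_imp_le) (use proj_pythagoras[of v x] in simp_all)

lemma proj_span: "v \<in> cspan E \<Longrightarrow> proj E v = v"
  using proj_best_approx[of v v] by simp

lemma range_proj: "range (proj E) = cspan E"
proof
  show "cspan E \<subseteq> range (proj E)"
    using proj_span by (metis rangeI subsetI)
qed (auto simp: proj_in_span)

lemma norm_proj_sq: "(norm (proj E x))\<^sup>2 = (\<Sum>e\<in>E. (cmod (cinner x e))\<^sup>2)"
proof -
  have "complex_of_real ((norm (proj E x))\<^sup>2) = (\<Sum>e\<in>E. cinner x e * cinner e (proj E x))"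
    unfolding cinner_self[symmetric]
    by (subst (1) proj_def) (simp add: cinner_sum_left cinner_scaleC_left)
  also have "\<dots> = (\<Sum>e\<in>E. cinner x e * cnj (cinner x e))"
    by (intro sum.cong refl, subst (2) cinner_commute) (simp add: cinner_proj)
  also have "\<dots> = complex_of_real (\<Sum>e\<in>E. (cmod (cinner x e))\<^sup>2)"
    by (simp only: of_real_sum complex_norm_square)
  finally show ?thesis
    using of_real_eq_iff by blast
qed

lemma norm_diff_proj_sq: "(norm (x - proj E x))\<^sup>2 = (norm x)\<^sup>2 - (\<Sum>e\<in>E. (cmod (cinner x e))\<^sup>2)"
  using proj_pythagoras[OF complex_vector.span_zero, of x] by (simp add: norm_proj_sq)

lemma bessel: "(\<Sum>e\<in>E. (cmod (cinner x e))\<^sup>2) \<le> (norm x)\<^sup>2"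
  using norm_diff_proj_sq[of x] by (smt (verit) zero_le_power2)

lemma norm_proj_le: "norm (proj E x) \<le> norm x"
  by (rule power2_le_imp_le) (simp_all add: norm_proj_sq bessel)

lemma bounded_clinear_proj: "bounded_clinear (proj E)"
proof -
  have add: "proj E (x + y) = proj E x + proj E y" for x y
    by (simp add: proj_def cinner_add_left scaleC_add_left sum.distrib)
  have scale: "proj E (c *\<^sub>C x) = c *\<^sub>C proj E x" for c x
    by (simp add: proj_def cinner_scaleC_left complex_vector.scale_sum_right)
  have "bounded_linear (proj E)"
    by (rule bounded_linear_intro[where K = 1])
       (simp_all add: add scale scaleR_scaleC norm_proj_le)
  then show ?thesis
    unfolding bounded_clinear_def using scale by blast
qed

lemma orthogonal_projection_proj: "orthogonal_projection (proj E)"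
proof -
  have 1: "cinner (proj E x) y = cinner (proj E x) (proj E y)" for x y
  proof -
    have "cinner (y - proj E y) (proj E x) = 0"
      by (rule cinner_diff_proj_span) (rule proj_in_span)
    then have "cinner (proj E x) (y - proj E y) = 0"
      by (subst cinner_commute) simp
    then show ?thesis
      by (simp add: cinner_diff_right)
  qed
  have "cinner (x - proj E x) (proj E y) = 0" for x y
    by (rule cinner_diff_proj_span) (rule proj_in_span)
  then have "cinner (proj E x) y = cinner x (proj E y)" for x y
    using 1 by (simp add: cinner_diff_left)
  then have "cadjoint (proj E) = proj E"
    by (rule cadjoint_eqI)
  then show ?thesis
    by (simp add: orthogonal_projection_def bounded_clinear_proj fun_eq_iff proj_span proj_in_span)
qed

lemma exists_unit_orthogonal:
  assumes "x \<notin> cspan E"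
  obtains u where "norm u = 1" "\<And>e. e \<in> E \<Longrightarrow> cinner u e = 0"
    "u = complex_of_real (1 / norm (x - proj E x)) *\<^sub>C (x - proj E x)"
proof
  let ?r = "x - proj E x" and ?u = "complex_of_real (1 / norm (x - proj E x)) *\<^sub>C (x - proj E x)"
  have "?r \<noteq> 0"
    using assms proj_in_span[of E x] by auto
  then show "norm ?u = 1"
    by (simp add: norm_scaleC norm_divide)
  show "cinner ?u e = 0" if "e \<in> E" for e
    by (simp add: cinner_scaleC_left cinner_diff_proj_span complex_vector.span_base that)
qed simp

lemma exists_orthonormal_extension:
  obtains E' where "finite E'" "orthonormal E'" "E \<subseteq> E'" "x \<in> cspan E'"
proof (cases "x \<in> cspan E")
  case False
  let ?r = "x - proj E x"
  obtain u where u: "norm u = 1" "\<And>e. e \<in> E \<Longrightarrow> cinner u e = 0"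
    "u = complex_of_real (1 / norm ?r) *\<^sub>C ?r"
    using exists_unit_orthogonal[OF False] by blast
  have "?r \<noteq> 0"
    using False proj_in_span[of E x] by auto
  then have "complex_of_real (norm ?r) *\<^sub>C u = ?r"
    unfolding u(3) complex_vector.scale_scale by (simp flip: of_real_mult)
  then have "x = complex_of_real (norm ?r) *\<^sub>C u + proj E x"
    by simp
  moreover have "proj E x \<in> cspan (insert u E)"
    using proj_in_span complex_vector.span_mono[of E "insert u E"] by blast
  ultimately have "x \<in> cspan (insert u E)"
    using complex_vector.span_add complex_vector.span_scale complex_vector.span_base
    by (metis insertI1)
  then show ?thesis
    using that[of "insert u E"] fin u orthonormal_insert[OF orth] by blast
qed (use that fin orth in blast)

end

lemma exists_orthonormal_superspan:
  fixes D :: "'a::complex_inner set"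
  assumes "finite D"
  shows "\<exists>E. finite E \<and> orthonormal E \<and> D \<subseteq> cspan E"
  using assms
proof (induction D)
  case empty
  then show ?case
    by (auto intro!: exI[of _ "{}"] simp: orthonormal_def)
next
  case (insert x D)
  then obtain E where E: "finite E" "orthonormal E" "D \<subseteq> cspan E"
    by blast
  then obtain E' where "finite E'" "orthonormal E'" "E \<subseteq> E'" "x \<in> cspan E'"
    using exists_orthonormal_extension by metis
  then show ?case
    using E complex_vector.span_mono[of E E'] by blast
qed

section \<open>Approximate eigenvectors\<close>

text \<open>Bounded sequences along which countably many given functions tend to zero.\<close>

definition null_along :: "(nat \<Rightarrow> 'a::real_normed_vector \<Rightarrow> real) \<Rightarrow> (nat \<Rightarrow> 'a) \<Rightarrow> bool"
  where "null_along f x \<longleftrightarrow> bounded (range x) \<and> (\<forall>k. (\<lambda>n. f k (x n)) \<longlonglongrightarrow> 0)"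

text \<open>
  A self-adjoint operator that preserves a space of sequences of this kind has an approximate
  eigenvalue with approximate eigenvectors in that space: the largest asymptotic value
  \<open>\<beta>\<close> of the quadratic form on unit vectors. Since \<open>C = \<beta> - B\<close> is asymptotically nonnegative
  on the space, testing its form on \<open>x - t *\<^sub>R C x\<close> for a maximising sequence \<open>x\<close> forces
  \<open>C x\<close> to tend to zero. Countability of the family makes it possible to attain the supremum by
  a diagonal choice.
\<close>

lemma exists_approximate_eigenvalue:
  fixes B :: "'a::real_inner \<Rightarrow> 'a" and f :: "nat \<Rightarrow> 'a \<Rightarrow> real"
  assumes B: "bounded_linear B" and selfadj: "\<And>x y. inner (B x) y = inner x (B y)"
    and f_nonneg: "\<And>k x. f k x \<ge> 0" and f_scale: "\<And>k c x. f k (c *\<^sub>R x) = \<bar>c\<bar> * f k x"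
    and closed: "\<And>x c t. null_along f x \<Longrightarrow> null_along f (\<lambda>n. c *\<^sub>R x n + t *\<^sub>R B (x n))"
    and x0: "null_along f x0" "\<And>n. norm (x0 n) = 1"
  shows "\<exists>\<beta> x. null_along f x \<and> (\<forall>n. norm (x n) = 1) \<and> (\<lambda>n. B (x n) - \<beta> *\<^sub>R x n) \<longlonglongrightarrow> 0"
proof -
  interpret bounded_linear B by fact
  obtain K where K: "K > 0" "\<And>x. norm (B x) \<le> norm x * K"
    using pos_bounded by blast
  define q where "q = (\<lambda>x. inner (B x) x)"
  have q_bound: "\<bar>q x\<bar> \<le> K * (norm x)\<^sup>2" for x
  proof -
    have "\<bar>q x\<bar> \<le> norm (B x) * norm x"
      unfolding q_def by (rule Cauchy_Schwarz_ineq2)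
    also have "\<dots> \<le> norm x * K * norm x"
      by (intro mult_right_mono K) simp
    finally show ?thesis
      by (simp add: power2_eq_square mult_ac)
  qed
  have q_scale: "q (c *\<^sub>R x) = c\<^sup>2 * q x" for c x
    by (simp add: q_def scaleR power2_eq_square)
  \<comment> \<open>The values that the quadratic form nearly exceeds on unit vectors at which any finitely many of
    the given functions are small.\<close>
  define S where "S = {b. \<forall>e>0. \<forall>k. \<exists>x. norm x = 1 \<and> (\<forall>i<k. f i x < e) \<and> b - e < q x}"
  have ev_small: "\<forall>\<^sub>F n in sequentially. \<forall>i<k. f i (x n) < e" if "null_along f x" "e > 0" for x k e
  proof -
    have "\<forall>\<^sub>F n in sequentially. \<forall>i\<in>{..<k}. f i (x n) < e"
    proof (intro eventually_ball_finite ballI)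
      fix i
      show "\<forall>\<^sub>F n in sequentially. f i (x n) < e"
        using that order_tendstoD(2) unfolding null_along_def by blast
    qed simp
    then show ?thesis
      by (simp add: Ball_def)
  qed
  have "- K \<in> S"
    unfolding S_def
  proof (intro CollectI allI impI)
    fix e :: real and k assume "e > 0"
    then obtain n where "\<forall>i<k. f i (x0 n) < e"
      using ev_small[OF x0(1)] eventually_happens'[OF sequentially_bot] by blast
    then show "\<exists>x. norm x = 1 \<and> (\<forall>i<k. f i x < e) \<and> - K - e < q x"
      using x0(2)[of n] q_bound[of "x0 n"] \<open>e > 0\<close> by (intro exI[of _ "x0 n"]) auto
  qed
  have S_le: "b \<le> K" if bS: "b \<in> S" for b
  proof (rule field_le_epsilon)
    fix e :: real assume "e > 0"
    then obtain x where "norm x = 1" "b - e < q x"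
      using bS unfolding S_def by blast
    then show "b \<le> K + e"
      using q_bound[of x] by simp
  qed
  then have bdd: "bdd_above S"
    by (rule bdd_aboveI)
  define \<beta> where "\<beta> = Sup S"
  have \<beta>: "\<exists>x. norm x = 1 \<and> (\<forall>i<k. f i x < e) \<and> \<beta> - e < q x" if e: "e > 0" for e k
  proof -
    obtain b where "b \<in> S" "\<beta> - e / 2 < b"
      using less_cSupD[of S "\<beta> - e / 2"] \<open>- K \<in> S\<close> e unfolding \<beta>_def by fastforce
    moreover from this obtain x where "norm x = 1" "\<forall>i<k. f i x < e / 2" "b - e / 2 < q x"
      using e unfolding S_def mem_Collect_eq by (meson half_gt_zero)
    ultimately show ?thesis
      using e by (intro exI[of _ x]) fastforce
  qed
  have "\<exists>x. norm x = 1 \<and> (\<forall>i<n. f i x < 1 / Suc n) \<and> \<beta> - 1 / Suc n < q x" for n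
    by (rule \<beta>) simp
  then obtain x where x1: "\<And>n. norm (x n) = 1" and xf: "\<And>n i. i < n \<Longrightarrow> f i (x n) < 1 / Suc n"
    and xq: "\<And>n. \<beta> - 1 / Suc n < q (x n)"
    by metis
  have lim1: "(\<lambda>n. 1 / real (Suc n)) \<longlonglongrightarrow> 0"
    using LIMSEQ_Suc[OF lim_1_over_n] by simp
  have null_x: "null_along f x"
    unfolding null_along_def
  proof (intro conjI allI)
    show "bounded (range x)"
      using x1 by (auto intro!: boundedI[of _ 1])
    fix k
    have "\<forall>\<^sub>F n in sequentially. f k (x n) \<le> 1 / Suc n"
      using eventually_gt_at_top[of k] by eventually_elim (rule less_imp_le[OF xf])
    then show "(\<lambda>n. f k (x n)) \<longlonglongrightarrow> 0"
      using tendsto_sandwich[OF _ _ tendsto_const lim1] by (simp add: f_nonneg)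
  qed
  \<comment> \<open>Rescaling a violating subsequence to unit length would exhibit an element of \<open>S\<close> above \<open>\<beta>\<close>.\<close>
  have upper: "\<forall>\<^sub>F n in sequentially. q (y n) < \<beta> * (norm (y n))\<^sup>2 + e"
    if y: "null_along f y" and "e > 0" for y e
  proof (rule ccontr)
    assume "\<not> ?thesis"
    then have freq: "\<exists>\<^sub>F n in sequentially. \<beta> * (norm (y n))\<^sup>2 + e \<le> q (y n)"
      by (simp add: not_eventually not_less)
    obtain R where R: "R > 0" "\<And>n. norm (y n) \<le> R"
      using y unfolding null_along_def by (metis bounded_pos rangeI)
    define h where "h = sqrt (e / (K + \<bar>\<beta>\<bar>))"
    have h: "h > 0"
      using K(1) \<open>e > 0\<close> by (simp add: h_def add_pos_nonneg)
    have "\<beta> + e / R\<^sup>2 \<in> S"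
      unfolding S_def
    proof (intro CollectI allI impI)
      fix e' :: real and k assume "e' > 0"
      then have "\<forall>\<^sub>F n in sequentially. \<forall>i<k. f i (y n) < e' * h"
        using h by (intro ev_small[OF y]) simp
      from frequently_ex[OF frequently_eventually_conj[OF freq this]]
      obtain n where n: "\<beta> * (norm (y n))\<^sup>2 + e \<le> q (y n)" "\<And>i. i < k \<Longrightarrow> f i (y n) < e' * h"
        by auto
      have "e \<le> \<bar>q (y n)\<bar> + \<bar>\<beta>\<bar> * (norm (y n))\<^sup>2"
        using n(1) abs_ge_self[of "q (y n)"] abs_ge_minus_self[of "\<beta> * (norm (y n))\<^sup>2"]
        by (simp add: abs_mult)
      also have "\<dots> \<le> (K + \<bar>\<beta>\<bar>) * (norm (y n))\<^sup>2"
        using q_bound[of "y n"] by (simp add: algebra_simps)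
      finally have "e / (K + \<bar>\<beta>\<bar>) \<le> (norm (y n))\<^sup>2"
        using K(1) by (simp add: pos_divide_le_eq add_pos_nonneg mult.commute)
      from real_sqrt_le_mono[OF this] have hy: "h \<le> norm (y n)"
        by (simp add: h_def)
      then have ny: "norm (y n) > 0"
        using h by linarith
      define z where "z = (1 / norm (y n)) *\<^sub>R y n"
      have "norm z = 1"
        using ny by (simp add: z_def)
      moreover have "f i z < e'" if "i < k" for i
      proof -
        have "f i (y n) < e' * norm (y n)"
          using n(2)[OF that] mult_left_mono[OF hy, of e'] \<open>e' > 0\<close> by linarith
        then show ?thesis
          using ny by (simp add: z_def f_scale pos_divide_less_eq)
      qed
      moreover have "\<beta> + e / R\<^sup>2 - e' < q z"
      proof -
        have "e / R\<^sup>2 \<le> e / (norm (y n))\<^sup>2"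
          using R ny \<open>e > 0\<close> by (intro divide_left_mono power_mono mult_pos_pos) auto
        moreover have "\<beta> + e / (norm (y n))\<^sup>2 \<le> q z"
          using divide_right_mono[OF n(1), of "(norm (y n))\<^sup>2"] ny
          by (simp add: z_def q_scale power_divide add_divide_distrib)
        ultimately show ?thesis
          using \<open>e' > 0\<close> by linarith
      qed
      ultimately show "\<exists>x. norm x = 1 \<and> (\<forall>i<k. f i x < e') \<and> \<beta> + e / R\<^sup>2 - e' < q x"
        by blast
    qed
    then have "\<beta> + e / R\<^sup>2 \<le> \<beta>"
      unfolding \<beta>_def by (rule cSup_upper[OF _ bdd])
    then show False
      using R \<open>e > 0\<close> by (simp add: divide_le_0_iff)
  qed
  define C where "C = (\<lambda>v. \<beta> *\<^sub>R v - B v)"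
  define L where "L = \<bar>\<beta>\<bar> + K"
  have L: "L > 0"
    using K(1) by (simp add: L_def add_nonneg_pos)
  have C_bound: "norm (C v) \<le> L * norm v" for v
    using norm_triangle_ineq4[of "\<beta> *\<^sub>R v" "B v"] K(2)[of v]
    by (simp add: C_def L_def algebra_simps)
  define r where "r = (\<lambda>v. inner (C v) v)"
  have r: "r v = \<beta> * (norm v)\<^sup>2 - q v" for v
    by (simp add: r_def C_def q_def inner_diff_left power2_norm_eq_inner)
  have C_selfadj: "inner (C v) w = inner v (C w)" for v w
    by (simp add: C_def inner_diff_left inner_diff_right selfadj)
  have C_lin: "C (v - t *\<^sub>R w) = C v - t *\<^sub>R C w" for v w t
    by (simp add: C_def diff scaleR algebra_simps)
  have r_step: "r (v - t *\<^sub>R C v) = r v - 2 * t * (norm (C v))\<^sup>2 + t\<^sup>2 * r (C v)" for v t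
    by (simp add: r_def C_lin inner_diff_left inner_diff_right power2_norm_eq_inner
        power2_eq_square[of t] C_selfadj[of "C v" v] algebra_simps)
  have small: "\<forall>\<^sub>F n in sequentially. (norm (C (x n)))\<^sup>2 < h" if "h > 0" for h
  proof -
    \<comment> \<open>In \<open>r_step\<close> the quadratic term is at most \<open>t\<^sup>2 * L ^ 3 = t * h\<close>, half of the available
      \<open>2 * t * h\<close>; the two errors \<open>e\<close> fit into the other half.\<close>
    define t where "t = h / L ^ 3"
    define e where "e = t * h / 4"
    have t: "t > 0" "e > 0" "t * L ^ 3 = h"
      using L that by (simp_all add: t_def e_def)
    have "null_along f (\<lambda>n. (1 - t * \<beta>) *\<^sub>R x n + t *\<^sub>R B (x n))"
      by (rule closed[OF null_x])
    then have "null_along f (\<lambda>n. x n - t *\<^sub>R C (x n))"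
      by (simp add: C_def algebra_simps)
    from upper[OF this t(2)]
    have "\<forall>\<^sub>F n in sequentially. - e < r (x n - t *\<^sub>R C (x n))"
      by eventually_elim (simp add: r)
    moreover have "\<forall>\<^sub>F n in sequentially. 1 / real (Suc n) < e"
      by (rule order_tendstoD(2)[OF lim1 t(2)])
    ultimately show ?thesis
    proof eventually_elim
      case (elim n)
      have rx: "r (x n) < e"
        using xq[of n] elim(2) by (simp only: r x1) simp
      have "norm (C (x n)) \<le> L"
        using C_bound[of "x n"] x1 by simp
      then have n2: "(norm (C (x n)))\<^sup>2 \<le> L\<^sup>2"
        by (intro power_mono) auto
      have "r (C (x n)) \<le> norm (C (C (x n))) * norm (C (x n))"
        unfolding r_def by (rule norm_cauchy_schwarz)
      also have "\<dots> \<le> L * norm (C (x n)) * norm (C (x n))"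
        by (intro mult_right_mono C_bound) simp
      also have "\<dots> \<le> L * L\<^sup>2"
        using n2 L by (simp add: power2_eq_square mult.assoc)
      finally have "t\<^sup>2 * r (C (x n)) \<le> t\<^sup>2 * (L * L\<^sup>2)"
        by (intro mult_left_mono) auto
      also have "\<dots> = t * (t * L ^ 3)"
        by (simp add: power2_eq_square power3_eq_cube)
      finally have "t\<^sup>2 * r (C (x n)) \<le> t * h"
        by (simp add: t)
      then have "2 * t * (norm (C (x n)))\<^sup>2 < 2 * e + t * h"
        using elim(1) rx unfolding r_step by linarith
      also have "\<dots> < 2 * t * h"
        using t(1) that by (simp add: e_def)
      finally show ?case
        using t(1) by simp
    qed
  qed
  have "(\<lambda>n. B (x n) - \<beta> *\<^sub>R x n) \<longlonglongrightarrow> 0"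
  proof (rule tendstoI)
    fix e :: real assume "e > 0"
    then have "\<forall>\<^sub>F n in sequentially. (norm (C (x n)))\<^sup>2 < e\<^sup>2"
      by (intro small) simp
    then show "\<forall>\<^sub>F n in sequentially. dist (B (x n) - \<beta> *\<^sub>R x n) 0 < e"
    proof eventually_elim
      case (elim n)
      then show ?case
        using \<open>e > 0\<close> power2_less_imp_less[of "norm (C (x n))" e] by (simp add: C_def norm_minus_commute)
    qed
  qed
  then show ?thesis
    using null_x x1 by blast
qed

text \<open>Weakly null sequences; for the real part of a complex inner product this is the same notion
  as for the complex inner product itself. Boundedness is part of the definition.\<close>

definition weakly_null :: "(nat \<Rightarrow> 'a::real_inner) \<Rightarrow> bool"
  where "weakly_null x \<longleftrightarrow> bounded (range x) \<and> (\<forall>y. (\<lambda>n. inner (x n) y) \<longlonglongrightarrow> 0)"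

lemma weakly_null_dense:
  fixes d :: "nat \<Rightarrow> 'a::real_inner"
  assumes dense: "closure (range d) = UNIV"
  shows "weakly_null x \<longleftrightarrow> bounded (range x) \<and> (\<forall>k. (\<lambda>n. inner (x n) (d k)) \<longlonglongrightarrow> 0)"
proof
  assume x: "bounded (range x) \<and> (\<forall>k. (\<lambda>n. inner (x n) (d k)) \<longlonglongrightarrow> 0)"
  then obtain R where R: "R > 0" "\<And>n. norm (x n) \<le> R"
    by (metis bounded_pos rangeI)
  have "(\<lambda>n. inner (x n) y) \<longlonglongrightarrow> 0" for y
  proof (rule tendstoI)
    fix e :: real assume "e > 0"
    then have "e / (2 * R) > 0"
      using R by simp
    then obtain k where k: "dist (d k) y < e / (2 * R)"
      using dense closure_approachable[of y "range d"] by auto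
    have "\<forall>\<^sub>F n in sequentially. dist (inner (x n) (d k)) 0 < e / 2"
      using x \<open>e > 0\<close> by (intro tendstoD) auto
    then show "\<forall>\<^sub>F n in sequentially. dist (inner (x n) y) 0 < e"
    proof eventually_elim
      case (elim n)
      have "\<bar>inner (x n) (y - d k)\<bar> \<le> norm (x n) * norm (y - d k)"
        by (rule Cauchy_Schwarz_ineq2)
      also have "\<dots> \<le> R * (e / (2 * R))"
        using R k by (intro mult_mono) (auto simp: dist_norm norm_minus_commute)
      also have "\<dots> = e / 2"
        using R by simp
      finally show ?case
        using elim abs_triangle_ineq[of "inner (x n) (y - d k)" "inner (x n) (d k)"]
        by (simp add: inner_diff_right)
    qed
  qed
  then show "weakly_null x"
    using x by (simp add: weakly_null_def)
qed (simp add: weakly_null_def)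

lemma bounded_range_combination:
  assumes "bounded (range x)" "bounded_linear B"
  shows "bounded (range (\<lambda>n::nat. c *\<^sub>R x n + t *\<^sub>R B (x n)))"
proof -
  have "bounded_linear (\<lambda>v. c *\<^sub>R v + t *\<^sub>R B v)"
    using assms(2) by (intro bounded_linear_intros)
  from bounded_linear_image[OF assms(1) this] show ?thesis
    by (simp add: image_image)
qed

lemma weakly_null_combination:
  assumes x: "weakly_null x" and B: "bounded_linear B" "\<And>v w. inner (B v) w = inner v (B w)"
  shows "weakly_null (\<lambda>n. c *\<^sub>R x n + t *\<^sub>R B (x n))"
  unfolding weakly_null_def
proof (intro conjI allI)
  show "bounded (range (\<lambda>n. c *\<^sub>R x n + t *\<^sub>R B (x n)))"
    using x B(1) by (intro bounded_range_combination) (auto simp: weakly_null_def)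
  fix y
  have "(\<lambda>n. c * inner (x n) y + t * inner (x n) (B y)) \<longlonglongrightarrow> c * 0 + t * 0"
    using x by (intro tendsto_intros) (auto simp: weakly_null_def)
  then show "(\<lambda>n. inner (c *\<^sub>R x n + t *\<^sub>R B (x n)) y) \<longlonglongrightarrow> 0"
    by (simp add: inner_add_left B(2))
qed

text \<open>Along a subsequence on which \<open>K x\<close> stays away from zero, compactness provides a limit point;
  it is orthogonal to itself, as \<open>K x\<close> tends weakly to zero.\<close>

lemma compact_weakly_null:
  fixes K :: "'a::real_inner \<Rightarrow> 'a"
  assumes K: "bounded_linear K" "compact (closure (K ` cball 0 1))"
    and adj: "\<And>v w. inner (K v) w = inner v (K' w)"
    and x: "weakly_null x"
  shows "(\<lambda>n. K (x n)) \<longlonglongrightarrow> 0"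
proof (rule tendstoI, rule ccontr)
  interpret bounded_linear K by fact
  fix e :: real
  assume "e > 0" and "\<not> (\<forall>\<^sub>F n in sequentially. dist (K (x n)) 0 < e)"
  then obtain s :: "nat \<Rightarrow> nat" where s: "strict_mono s" "\<And>n. e \<le> norm (K (x (s n)))"
    by (auto dest!: not_eventually_sequentiallyD simp: not_less)
  obtain R where R: "R > 0" "\<And>n. norm (x n) \<le> R"
    using x unfolding weakly_null_def by (metis bounded_pos rangeI)
  define z where "z = (\<lambda>n. (1 / R) *\<^sub>R K (x (s n)))"
  have "z n \<in> closure (K ` cball 0 1)" for n
  proof -
    have "z n = K ((1 / R) *\<^sub>R x (s n))" "norm ((1 / R) *\<^sub>R x (s n)) \<le> 1"
      using R by (simp_all add: z_def scaleR)
    then show ?thesis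
      using closure_subset by fastforce
  qed
  then obtain l s' where s': "strict_mono (s' :: nat \<Rightarrow> nat)" and l: "(z \<circ> s') \<longlonglongrightarrow> l"
    using K(2) unfolding compact_def by metis
  have "(\<lambda>n. inner (x n) (K' l)) \<longlonglongrightarrow> 0"
    using x by (simp add: weakly_null_def)
  then have "((\<lambda>n. inner (x n) (K' l)) \<circ> (s \<circ> s')) \<longlonglongrightarrow> 0"
    by (rule LIMSEQ_subseq_LIMSEQ) (rule strict_mono_o[OF s(1) s'])
  then have "(\<lambda>n. (1 / R) * inner (x (s (s' n))) (K' l)) \<longlonglongrightarrow> (1 / R) * 0"
    by (intro tendsto_intros) (simp add: o_def)
  then have "(\<lambda>n. inner ((z \<circ> s') n) l) \<longlonglongrightarrow> 0"
    by (simp add: z_def adj)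
  moreover have "(\<lambda>n. inner ((z \<circ> s') n) l) \<longlonglongrightarrow> inner l l"
    by (intro tendsto_intros l)
  ultimately have "inner l l = 0"
    using LIMSEQ_unique by blast
  then have "(\<lambda>n. norm ((z \<circ> s') n)) \<longlonglongrightarrow> 0"
    using tendsto_norm[OF l] by simp
  moreover have "e / R \<le> norm ((z \<circ> s') n)" for n
    using s(2)[of "s' n"] R by (simp add: z_def divide_right_mono)
  ultimately have "e / R \<le> 0"
    by (intro LIMSEQ_le_const) auto
  then show False
    using R \<open>e > 0\<close> by (simp add: divide_le_0_iff)
qed

lemma all_nat_zero_Suc: "(\<forall>k. P k) \<longleftrightarrow> P 0 \<and> (\<forall>k. P (Suc k))"
  by (metis not0_implies_Suc)

lemma exists_weakly_null_unit:
  fixes d :: "nat \<Rightarrow> 'a::complex_inner"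
  assumes dense: "closure (range d) = UNIV" and infdim: "\<And>E::'a set. finite E \<Longrightarrow> cspan E \<noteq> UNIV"
  obtains x :: "nat \<Rightarrow> 'a" where "weakly_null x" "\<And>n. norm (x n) = 1"
proof -
  have "\<exists>u. norm u = 1 \<and> (\<forall>i<n. inner u (d i) = 0)" for n
  proof -
    obtain E where E: "finite E" "orthonormal E" "d ` {..<n} \<subseteq> cspan E"
      using exists_orthonormal_superspan[of "d ` {..<n}"] by auto
    obtain x where "x \<notin> cspan E"
      using infdim[OF E(1)] by auto
    from exists_unit_orthogonal[OF E(1,2) this]
    obtain u where u: "norm u = 1"
      "u = complex_of_real (1 / norm (x - proj E x)) *\<^sub>C (x - proj E x)"
      by metis
    have "inner u (d i) = 0" if "i < n" for i
    proof -
      have "d i \<in> cspan E"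
        using E(3) that by auto
      then show ?thesis
        by (simp add: inner_eq_Re_cinner u(2) cinner_scaleC_left cinner_diff_proj_span[OF E(1,2)])
    qed
    then show ?thesis
      using u(1) by blast
  qed
  then obtain x where x: "\<And>n. norm (x n) = 1" "\<And>n i. i < n \<Longrightarrow> inner (x n) (d i) = 0"
    by metis
  have "bounded (range x)"
    using x(1) by (auto intro!: boundedI[of _ 1])
  moreover have "(\<lambda>n. inner (x n) (d k)) \<longlonglongrightarrow> 0" for k
  proof (rule tendsto_eventually)
    show "\<forall>\<^sub>F n in sequentially. inner (x n) (d k) = 0"
      using eventually_gt_at_top[of k] by eventually_elim (rule x(2))
  qed
  ultimately have "weakly_null x"
    using weakly_null_dense[OF dense] by blast
  then show ?thesis
    by (rule that) (rule x(1))
qed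

text \<open>
  Applied first to the real part \<open>A\<close> of \<open>T\<close> on all weakly null sequences, and then to the imaginary
  part \<open>B\<close> on those weakly null sequences that are approximate eigenvectors of \<open>A\<close>, the existence of
  approximate eigenvalues produces joint approximate eigenvectors of \<open>T\<close> and its adjoint. The second
  space of sequences is preserved by \<open>B\<close> because the commutator of \<open>A\<close> and \<open>B\<close> is compact.
\<close>

lemma essentially_normal_approximate_eigenvectors:
  fixes T :: "'a::complex_hilbert_space \<Rightarrow> 'a" and d :: "nat \<Rightarrow> 'a"
  assumes T: "bounded_clinear T" and en: "essentially_normal T"
    and dense: "closure (range d) = UNIV" and infdim: "\<And>E::'a set. finite E \<Longrightarrow> cspan E \<noteq> UNIV"
  obtains \<mu> and x :: "nat \<Rightarrow> 'a" where "weakly_null x" "\<And>n. norm (x n) = 1"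
    "(\<lambda>n. T (x n) - \<mu> *\<^sub>C x n) \<longlonglongrightarrow> 0" "(\<lambda>n. cadjoint T (x n) - cnj \<mu> *\<^sub>C x n) \<longlonglongrightarrow> 0"
proof -
  define S where "S = cadjoint T"
  have S: "bounded_clinear S"
    unfolding S_def by (rule bounded_clinear_cadjoint[OF T])
  note lin = bounded_clinear_simps[OF T] bounded_clinear_simps[OF S]
  have blin: "bounded_linear T" "bounded_linear S"
    using T S by (auto simp: bounded_clinear_def)
  have bi: "bounded_linear ((*\<^sub>C) \<i> :: 'a \<Rightarrow> 'a)"
    by (rule bounded_linear_intro[where K = 1])
       (simp_all add: scaleC_add_right scaleR_scaleC norm_scaleC mult.commute)
  define A where "A = (\<lambda>v. (1/2) *\<^sub>R (T v + S v))"
  define B where "B = (\<lambda>v. (1/2) *\<^sub>R (\<i> *\<^sub>C (S v - T v)))"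
  have A: "bounded_linear A"
    unfolding A_def using blin by (intro bounded_linear_intros)
  have B: "bounded_linear B"
    unfolding B_def
    by (intro bounded_linear_const_scaleR bounded_linear_compose[OF bi] bounded_linear_sub blin)
  interpret A: bounded_linear A by fact
  interpret B: bounded_linear B by fact
  have adj: "inner (T v) w = inner v (S w)" for v w
    by (simp add: inner_eq_Re_cinner S_def cinner_cadjoint[OF T])
  have adj': "inner (S v) w = inner v (T w)" for v w
    using adj[of w v] by (simp add: inner_commute)
  have inner_i: "inner (\<i> *\<^sub>C v) w = - inner v (\<i> *\<^sub>C w)" for v w :: 'a
    by (simp add: inner_eq_Re_cinner cinner_scaleC_left cinner_scaleC_right)
  have A_sa: "inner (A v) w = inner v (A w)" for v w
    by (simp add: A_def inner_add_left inner_add_right adj adj')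
  have B_sa: "inner (B v) w = inner v (B w)" for v w
    by (simp add: B_def inner_i scaleC_diff_right inner_diff_left inner_diff_right adj adj' lin
        flip: lin(3) lin(9))
  define K where "K = (\<lambda>v. T (S v) - S (T v))"
  have K: "bounded_linear K" "compact (closure (K ` cball 0 1))"
    using en by (auto simp: essentially_normal_def compact_operator_def bounded_clinear_def K_def S_def)
  have K_sa: "inner (K v) w = inner v (K w)" for v w
    by (simp add: K_def inner_diff_left inner_diff_right adj adj')
  have comm: "A (B v) - B (A v) = (1/2) *\<^sub>R (\<i> *\<^sub>C K v)" for v
  proof -
    have half: "(1/2) *\<^sub>R w + (1/2) *\<^sub>R w = w" for w :: 'a
      by (simp flip: scaleR_left.add)
    have "4 *\<^sub>R (A (B v) - B (A v)) = 4 *\<^sub>R ((1/2) *\<^sub>R (\<i> *\<^sub>C K v))"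
      by (simp add: A_def B_def K_def lin scaleC_diff_right scaleC_add_right scaleR_right_diff_distrib
          scaleR_add_right linear_simps(5)[OF bi] half scaleR_2)
    then show ?thesis
      by (rule scaleR_left_imp_eq[rotated]) simp
  qed
  define f where "f = (\<lambda>k x. \<bar>inner x (d k)\<bar>)"
  have null_f: "null_along f x \<longleftrightarrow> weakly_null x" for x
    unfolding weakly_null_dense[OF dense] null_along_def f_def
    by (simp add: tendsto_rabs_zero_iff)
  obtain x0 :: "nat \<Rightarrow> 'a" where x0: "weakly_null x0" "\<And>n. norm (x0 n) = 1"
    by (rule exists_weakly_null_unit[OF dense infdim]) blast+
  have "\<exists>\<alpha> x. null_along f x \<and> (\<forall>n. norm (x n) = 1) \<and> (\<lambda>n. A (x n) - \<alpha> *\<^sub>R x n) \<longlonglongrightarrow> 0"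
  proof (rule exists_approximate_eigenvalue[OF A A_sa, of f x0])
    show "null_along f (\<lambda>n. c *\<^sub>R x n + t *\<^sub>R A (x n))" if "null_along f x" for x c t
      using that weakly_null_combination[OF _ A A_sa] by (simp add: null_f)
  qed (simp_all only: x0 null_f, simp_all add: f_def abs_mult)
  then obtain \<alpha> x1 where x1: "weakly_null x1" "\<And>n. norm (x1 n) = 1" "(\<lambda>n. A (x1 n) - \<alpha> *\<^sub>R x1 n) \<longlonglongrightarrow> 0"
    unfolding null_f by blast
  define g where "g = (\<lambda>k x. case k of 0 \<Rightarrow> norm (A x - \<alpha> *\<^sub>R x) | Suc k \<Rightarrow> f k x)"
  have null_g: "null_along g x \<longleftrightarrow> weakly_null x \<and> (\<lambda>n. A (x n) - \<alpha> *\<^sub>R x n) \<longlonglongrightarrow> 0" for x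
    unfolding null_f[symmetric] null_along_def
    by (subst all_nat_zero_Suc[of "\<lambda>k. (\<lambda>n. g k (x n)) \<longlonglongrightarrow> 0"])
       (auto simp: g_def tendsto_norm_zero_iff)
  have "\<exists>\<beta> x. null_along g x \<and> (\<forall>n. norm (x n) = 1) \<and> (\<lambda>n. B (x n) - \<beta> *\<^sub>R x n) \<longlonglongrightarrow> 0"
  proof (rule exists_approximate_eigenvalue[OF B B_sa, of g x1])
    show "null_along g (\<lambda>n. c *\<^sub>R x n + t *\<^sub>R B (x n))" if x: "null_along g x" for x c t
      unfolding null_g
    proof
      show "weakly_null (\<lambda>n. c *\<^sub>R x n + t *\<^sub>R B (x n))"
        using x weakly_null_combination[OF _ B B_sa] by (simp add: null_g)
      have "(\<lambda>n. A (x n) - \<alpha> *\<^sub>R x n) \<longlonglongrightarrow> 0"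
        using x by (simp add: null_g)
      moreover have "(\<lambda>n. K (x n)) \<longlonglongrightarrow> 0"
        using x by (intro compact_weakly_null[OF K K_sa]) (simp add: null_g)
      ultimately have "(\<lambda>n. c *\<^sub>R (A (x n) - \<alpha> *\<^sub>R x n) + t *\<^sub>R B (A (x n) - \<alpha> *\<^sub>R x n)
          + t *\<^sub>R ((1/2) *\<^sub>R (\<i> *\<^sub>C K (x n)))) \<longlonglongrightarrow> c *\<^sub>R 0 + t *\<^sub>R B 0 + t *\<^sub>R ((1/2) *\<^sub>R (\<i> *\<^sub>C 0))"
        by (intro tendsto_intros B.tendsto bounded_linear.tendsto[OF bi])
      moreover have "A (c *\<^sub>R v + t *\<^sub>R B v) - \<alpha> *\<^sub>R (c *\<^sub>R v + t *\<^sub>R B v) = c *\<^sub>R (A v - \<alpha> *\<^sub>R v)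
          + t *\<^sub>R B (A v - \<alpha> *\<^sub>R v) + t *\<^sub>R ((1/2) *\<^sub>R (\<i> *\<^sub>C K v))" for v
        unfolding comm[symmetric] by (simp add: A.add A.scaleR B.diff B.scaleR algebra_simps)
      ultimately show "(\<lambda>n. A (c *\<^sub>R x n + t *\<^sub>R B (x n)) - \<alpha> *\<^sub>R (c *\<^sub>R x n + t *\<^sub>R B (x n))) \<longlonglongrightarrow> 0"
        by (simp add: B.zero)
    qed
    show "g k x \<ge> 0" for k x
      by (simp add: g_def f_def split: nat.split)
    show "g k (c *\<^sub>R x) = \<bar>c\<bar> * g k x" for k c x
    proof -
      have "A (c *\<^sub>R x) - \<alpha> *\<^sub>R c *\<^sub>R x = c *\<^sub>R (A x - \<alpha> *\<^sub>R x)"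
        by (simp add: A.scaleR algebra_simps)
      then show ?thesis
        by (simp add: g_def f_def abs_mult split: nat.split)
    qed
    show "null_along g x1"
      using x1 by (simp add: null_g)
  qed (rule x1(2))
  then obtain \<beta> x where x: "weakly_null x" "\<And>n. norm (x n) = 1"
    and x_A: "(\<lambda>n. A (x n) - \<alpha> *\<^sub>R x n) \<longlonglongrightarrow> 0" and x_B: "(\<lambda>n. B (x n) - \<beta> *\<^sub>R x n) \<longlonglongrightarrow> 0"
    unfolding null_g by blast
  define \<mu> where "\<mu> = complex_of_real \<alpha> + \<i> * complex_of_real \<beta>"
  have \<mu>: "\<mu> *\<^sub>C v = \<alpha> *\<^sub>R v + \<i> *\<^sub>C (\<beta> *\<^sub>R v)" "cnj \<mu> *\<^sub>C v = \<alpha> *\<^sub>R v - \<i> *\<^sub>C (\<beta> *\<^sub>R v)" for v :: 'a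
    by (simp_all add: \<mu>_def scaleR_scaleC scaleC_add_left complex_vector.scale_left_diff_distrib)
  have i_B: "\<i> *\<^sub>C B v = (1/2) *\<^sub>R (T v - S v)" for v
    by (simp add: B_def linear_simps(5)[OF bi])
  have T_eq: "T v = A v + \<i> *\<^sub>C B v" and S_eq: "S v = A v - \<i> *\<^sub>C B v" for v
    unfolding i_B by (simp_all add: A_def flip: scaleR_add_right scaleR_right_diff_distrib scaleR_2)
  have "(\<lambda>n. (A (x n) - \<alpha> *\<^sub>R x n) + \<i> *\<^sub>C (B (x n) - \<beta> *\<^sub>R x n)) \<longlonglongrightarrow> 0 + \<i> *\<^sub>C 0"
    "(\<lambda>n. (A (x n) - \<alpha> *\<^sub>R x n) - \<i> *\<^sub>C (B (x n) - \<beta> *\<^sub>R x n)) \<longlonglongrightarrow> 0 - \<i> *\<^sub>C 0"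
    by (intro tendsto_intros bounded_linear.tendsto[OF bi] x_A x_B)+
  then have "(\<lambda>n. T (x n) - \<mu> *\<^sub>C x n) \<longlonglongrightarrow> 0" "(\<lambda>n. S (x n) - cnj \<mu> *\<^sub>C x n) \<longlonglongrightarrow> 0"
    by (simp_all add: \<mu> T_eq S_eq scaleC_diff_right algebra_simps)
  then show ?thesis
    using that x unfolding S_def by blast
qed

lemma weakly_null_cinner:
  fixes x :: "nat \<Rightarrow> 'a::complex_inner"
  assumes "weakly_null x"
  shows "(\<lambda>n. cinner (x n) y) \<longlonglongrightarrow> 0"
  using assms
  by (auto simp: tendsto_complex_iff weakly_null_def Im_cinner inner_eq_Re_cinner[symmetric])

lemma exists_orthogonal_approximate_eigenvector:
  fixes T S :: "'a::complex_inner \<Rightarrow> 'a"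
  assumes T: "bounded_clinear T" and S: "bounded_clinear S"
    and x: "weakly_null x" "\<And>n. norm (x n) = 1"
    and x_T: "(\<lambda>n. T (x n) - \<mu> *\<^sub>C x n) \<longlonglongrightarrow> 0" and x_S: "(\<lambda>n. S (x n) - \<nu> *\<^sub>C x n) \<longlonglongrightarrow> 0"
    and E: "finite E" "orthonormal E" and "e > 0"
  shows "\<exists>u. norm u = 1 \<and> (\<forall>b\<in>E. cinner u b = 0) \<and> norm (T u - \<mu> *\<^sub>C u) < e \<and> norm (S u - \<nu> *\<^sub>C u) < e"
proof -
  define p where "p = (\<lambda>n. proj E (x n))"
  have "(\<lambda>n. \<Sum>b\<in>E. (cmod (cinner (x n) b))\<^sup>2) \<longlonglongrightarrow> (\<Sum>b\<in>E. (cmod 0)\<^sup>2)"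
    by (intro tendsto_intros weakly_null_cinner x)
  then have "(\<lambda>n. (norm (p n))\<^sup>2) \<longlonglongrightarrow> 0"
    by (simp add: p_def norm_proj_sq[OF E])
  then have p: "p \<longlonglongrightarrow> 0"
    using tendsto_real_sqrt[of "\<lambda>n. (norm (p n))\<^sup>2" 0] by (simp add: tendsto_norm_zero_iff)
  define v where "v = (\<lambda>n. x n - p n)"
  have norm_v: "(\<lambda>n. norm (v n)) \<longlonglongrightarrow> 1"
  proof -
    have "(\<lambda>n. 1 - (norm (p n))\<^sup>2) \<longlonglongrightarrow> 1 - (norm (0::'a))\<^sup>2"
      by (intro tendsto_intros p)
    moreover have "(norm (v n))\<^sup>2 = 1 - (norm (p n))\<^sup>2" for n
      unfolding v_def p_def norm_diff_proj_sq[OF E] norm_proj_sq[OF E] x(2) by simp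
    ultimately have "(\<lambda>n. (norm (v n))\<^sup>2) \<longlonglongrightarrow> 1"
      by simp
    then show ?thesis
      using tendsto_real_sqrt[of "\<lambda>n. (norm (v n))\<^sup>2" 1] by simp
  qed
  have ev: "\<forall>\<^sub>F n in sequentially. norm (R (v n) - \<rho> *\<^sub>C v n) / norm (v n) < e"
    if R: "bounded_clinear R" and lim: "(\<lambda>n. R (x n) - \<rho> *\<^sub>C x n) \<longlonglongrightarrow> 0" for R \<rho>
  proof -
    have "bounded_linear (\<lambda>w::'a. \<rho> *\<^sub>C w)"
      by (rule bounded_linear_intro[where K = "cmod \<rho>"])
         (simp_all add: scaleC_add_right scaleR_scaleC norm_scaleC mult.commute)
    then have "(\<lambda>n. (R (x n) - \<rho> *\<^sub>C x n) - (R (p n) - \<rho> *\<^sub>C p n)) \<longlonglongrightarrow> 0 - (R 0 - \<rho> *\<^sub>C 0)"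
      using R unfolding bounded_clinear_def
      by (intro tendsto_diff lim bounded_linear.tendsto[OF _ p]) auto
    then have "(\<lambda>n. R (v n) - \<rho> *\<^sub>C v n) \<longlonglongrightarrow> 0"
      by (simp add: v_def bounded_clinear_simps[OF R] scaleC_diff_right algebra_simps)
    then have "(\<lambda>n. norm (R (v n) - \<rho> *\<^sub>C v n) / norm (v n)) \<longlonglongrightarrow> norm (0::'a) / 1"
      by (intro tendsto_intros norm_v) auto
    then show ?thesis
      using order_tendstoD(2) \<open>e > 0\<close> by fastforce
  qed
  have "\<forall>\<^sub>F n in sequentially. norm (v n) > 0"
    by (rule order_tendstoD(1)[OF norm_v]) simp
  with ev[OF T x_T] ev[OF S x_S]
  have "\<forall>\<^sub>F n in sequentially. norm (v n) > 0 \<and> norm (T (v n) - \<mu> *\<^sub>C v n) / norm (v n) < e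
      \<and> norm (S (v n) - \<nu> *\<^sub>C v n) / norm (v n) < e"
    by eventually_elim blast
  then obtain n where n: "norm (v n) > 0" "norm (T (v n) - \<mu> *\<^sub>C v n) / norm (v n) < e"
      "norm (S (v n) - \<nu> *\<^sub>C v n) / norm (v n) < e"
    using eventually_happens'[OF sequentially_bot] by blast
  define c where "c = complex_of_real (1 / norm (v n))"
  have scale: "norm (R (c *\<^sub>C v n) - \<rho> *\<^sub>C c *\<^sub>C v n) = norm (R (v n) - \<rho> *\<^sub>C v n) / norm (v n)"
    if "bounded_clinear R" for R \<rho>
  proof -
    have "R (c *\<^sub>C v n) - \<rho> *\<^sub>C c *\<^sub>C v n = c *\<^sub>C (R (v n) - \<rho> *\<^sub>C v n)"
      by (simp add: bounded_clinear_simps[OF that] scaleC_diff_right mult.commute)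
    then show ?thesis
      by (simp add: norm_scaleC c_def norm_divide)
  qed
  have "cinner (c *\<^sub>C v n) b = 0" if "b \<in> E" for b
    using cinner_diff_proj_span[OF E complex_vector.span_base[OF that]]
    by (simp add: cinner_scaleC_left v_def p_def)
  moreover have "norm (c *\<^sub>C v n) = 1"
    using n(1) by (simp add: norm_scaleC c_def norm_divide)
  ultimately show ?thesis
    using n(2,3) scale[OF T] scale[OF S] by (intro exI[of _ "c *\<^sub>C v n"]) auto
qed

section \<open>Hilbert-Schmidt estimates\<close>

text \<open>The Hilbert-Schmidt norm of \<open>D\<close> is at most \<open>c\<close>, tested on finite orthonormal sets.\<close>

definition hs_bounded :: "('a::complex_inner \<Rightarrow> 'a) \<Rightarrow> real \<Rightarrow> bool"
  where "hs_bounded D c \<longleftrightarrow> (\<forall>F. finite F \<longrightarrow> orthonormal F \<longrightarrow> L2_set (\<lambda>e. norm (D e)) F \<le> c)"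

lemma hs_bounded_add:
  assumes "hs_bounded D c" "hs_bounded D' c'"
  shows "hs_bounded (\<lambda>x. D x + D' x) (c + c')"
  unfolding hs_bounded_def
proof (intro allI impI)
  fix F :: "'a set" assume F: "finite F" "orthonormal F"
  have "L2_set (\<lambda>e. norm (D e + D' e)) F \<le> L2_set (\<lambda>e. norm (D e) + norm (D' e)) F"
    by (intro L2_set_mono norm_triangle_ineq) auto
  also have "\<dots> \<le> L2_set (\<lambda>e. norm (D e)) F + L2_set (\<lambda>e. norm (D' e)) F"
    by (rule L2_set_triangle_ineq)
  also have "\<dots> \<le> c + c'"
    using assms F unfolding hs_bounded_def by (intro add_mono) auto
  finally show "L2_set (\<lambda>e. norm (D e + D' e)) F \<le> c + c'" .
qed

lemma hs_bounded_minus: "hs_bounded D c \<Longrightarrow> hs_bounded (\<lambda>x. - D x) c"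
  by (simp add: hs_bounded_def)

lemma hs_bounded_zero: "hs_bounded (\<lambda>x. 0) 0"
  by (simp add: hs_bounded_def L2_set_0')

lemma hs_bounded_sum:
  assumes "\<And>i. i \<in> I \<Longrightarrow> hs_bounded (D i) (c i)"
  shows "hs_bounded (\<lambda>x. \<Sum>i\<in>I. D i x) (\<Sum>i\<in>I. c i)"
  using assms
  by (induction I rule: infinite_finite_induct) (simp_all add: hs_bounded_zero hs_bounded_add)

lemma hs_bounded_rank_one: "hs_bounded (\<lambda>x. cinner x a *\<^sub>C b) (norm a * norm b)"
  unfolding hs_bounded_def
proof (intro allI impI)
  fix F :: "'a set" assume F: "finite F" "orthonormal F"
  have "cmod (cinner e a) = cmod (cinner a e)" for e
    by (subst cinner_commute) simp
  then have "L2_set (\<lambda>e. cmod (cinner e a)) F \<le> norm a"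
    unfolding L2_set_def using bessel[OF F, of a] by (simp add: real_le_lsqrt sum_nonneg)
  then have "L2_set (\<lambda>e. cmod (cinner e a)) F * norm b \<le> norm a * norm b"
    by (rule mult_right_mono) simp
  then show "L2_set (\<lambda>e. norm (cinner e a *\<^sub>C b)) F \<le> norm a * norm b"
    by (simp add: norm_scaleC L2_set_left_distrib)
qed

text \<open>The commutator of \<open>T\<close> with a projection is a sum of operators of rank at most one, in which the
  freely chosen numbers \<open>\<mu> f\<close> cancel.\<close>

lemma hs_bounded_commutator:
  assumes T: "bounded_clinear T" and adj: "\<And>x y. cinner (T x) y = cinner x (S y)"
    and E: "orthonormal E"
  shows "hs_bounded (\<lambda>x. T (proj E x) - proj E (T x))
    (\<Sum>f\<in>E. norm (T f - \<mu> f *\<^sub>C f) + norm (S f - cnj (\<mu> f) *\<^sub>C f))"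
proof -
  have eq: "T (proj E x) - proj E (T x) =
      (\<Sum>f\<in>E. cinner x f *\<^sub>C (T f - \<mu> f *\<^sub>C f) + - (cinner x (S f - cnj (\<mu> f) *\<^sub>C f) *\<^sub>C f))" for x
    unfolding proj_def bounded_clinear_simps[OF T] sum_subtractf[symmetric]
    by (intro sum.cong refl)
       (simp add: adj cinner_diff_right cinner_scaleC_right scaleC_diff_right
         complex_vector.scale_left_diff_distrib mult.commute)
  have "hs_bounded (\<lambda>x. cinner x f *\<^sub>C (T f - \<mu> f *\<^sub>C f) + - (cinner x (S f - cnj (\<mu> f) *\<^sub>C f) *\<^sub>C f))
      (norm (T f - \<mu> f *\<^sub>C f) + norm (S f - cnj (\<mu> f) *\<^sub>C f))" if "f \<in> E" for f
    using hs_bounded_add[OF hs_bounded_rank_one[of f] hs_bounded_minus[OF hs_bounded_rank_one[of _ f]]]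
    by (simp add: orthonormal_norm[OF E that])
  then show ?thesis
    unfolding eq by (rule hs_bounded_sum)
qed

lemma orthonormal_basis_iff: "orthonormal_basis B \<longleftrightarrow> orthonormal B \<and> closure (cspan B) = UNIV"
  by (simp add: orthonormal_basis_def orthonormal_def)

lemma hs_norm_nonneg: "0 \<le> hs_norm D"
  by (simp add: hs_norm_def Let_def infsum_nonneg)

lemma hs_norm_le:
  fixes D :: "'a::complex_hilbert_space \<Rightarrow> 'a"
  assumes ex: "\<exists>B::'a set. orthonormal_basis B" and D: "hs_bounded D c"
  shows "hs_norm D \<le> c"
proof -
  define B :: "'a set" where "B = (SOME B. orthonormal_basis B)"
  have B: "orthonormal B"
    using someI_ex[OF ex] by (simp add: B_def orthonormal_basis_iff)
  have c: "c \<ge> 0"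
    using D[unfolded hs_bounded_def, rule_format, of "{}"] by (simp add: orthonormal_def)
  have le: "(\<Sum>e\<in>F. (norm (D e))\<^sup>2) \<le> c\<^sup>2" if "finite F" "F \<subseteq> B" for F
  proof -
    have "sqrt (\<Sum>e\<in>F. (norm (D e))\<^sup>2) \<le> c"
      using D that orthonormal_subset[OF B] unfolding hs_bounded_def L2_set_def by blast
    then show ?thesis
      by (rule sqrt_le_D)
  qed
  then have "(\<lambda>e. (norm (D e))\<^sup>2) summable_on B"
    by (intro nonneg_bdd_above_summable_on bdd_aboveI[of _ "c\<^sup>2"]) auto
  then have "(\<Sum>\<^sub>\<infinity>e\<in>B. (norm (D e))\<^sup>2) \<le> c\<^sup>2"
    by (rule infsum_le_finite_sums) (rule le)
  then show ?thesis
    unfolding hs_norm_def Let_def B_def[symmetric] by (rule real_le_lsqrt[OF c])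
qed

lemma parseval:
  assumes B: "orthonormal_basis B"
  shows "((\<lambda>e. (cmod (cinner x e))\<^sup>2) has_sum (norm x)\<^sup>2) B"
  unfolding has_sum_def
proof (rule tendstoI)
  fix r :: real assume "r > 0"
  have "x \<in> closure (cspan B)"
    using B by (simp add: orthonormal_basis_iff)
  then obtain v where v: "v \<in> cspan B" "norm (x - v) < sqrt r"
    using \<open>r > 0\<close> unfolding closure_approachable dist_norm
    by (metis norm_minus_commute real_sqrt_gt_0_iff)
  then obtain F c where F: "finite F" "F \<subseteq> B" and v_eq: "v = (\<Sum>a\<in>F. c a *\<^sub>C a)"
    unfolding complex_vector.span_explicit[of B] by blast
  have vF: "v \<in> cspan F"
    unfolding v_eq
    by (intro complex_vector.span_sum complex_vector.span_scale complex_vector.span_base)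
  show "\<forall>\<^sub>F G in finite_subsets_at_top B. dist (\<Sum>e\<in>G. (cmod (cinner x e))\<^sup>2) ((norm x)\<^sup>2) < r"
    unfolding eventually_finite_subsets_at_top
  proof (intro exI[of _ F] conjI F allI impI)
    fix G assume G: "finite G \<and> F \<subseteq> G \<and> G \<subseteq> B"
    then have fin: "finite G" and orth: "orthonormal G" and vG: "v \<in> cspan G"
      using B vF complex_vector.span_mono[of F G]
      by (auto simp: orthonormal_basis_iff elim: orthonormal_subset)
    have "norm (x - proj G x) < sqrt r"
      using proj_best_approx[OF fin orth vG, of x] v(2) by linarith
    then have "(norm (x - proj G x))\<^sup>2 < (sqrt r)\<^sup>2"
      by (intro power_strict_mono) auto
    then show "dist (\<Sum>e\<in>G. (cmod (cinner x e))\<^sup>2) ((norm x)\<^sup>2) < r"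
      using \<open>r > 0\<close> bessel[OF fin orth, of x] unfolding norm_diff_proj_sq[OF fin orth]
      by (simp add: dist_real_def)
  qed
qed

lemma hs_norm_proj:
  fixes E :: "'a::complex_hilbert_space set"
  assumes ex: "\<exists>B::'a set. orthonormal_basis B" and E: "finite E" "orthonormal E"
  shows "hs_norm (proj E) = sqrt (card E)"
proof -
  define B :: "'a set" where "B = (SOME B. orthonormal_basis B)"
  have B: "orthonormal_basis B"
    using someI_ex[OF ex] by (simp add: B_def)
  have "((\<lambda>e. \<Sum>f\<in>E'. (cmod (cinner f e))\<^sup>2) has_sum (\<Sum>f\<in>E'. (norm f)\<^sup>2)) B" if "finite E'" for E'
    using that by (induction E') (auto intro!: has_sum_add parseval[OF B])
  from this[OF E(1)] have "((\<lambda>e. \<Sum>f\<in>E. (cmod (cinner f e))\<^sup>2) has_sum card E) B"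
    by (simp add: orthonormal_norm[OF E(2)])
  moreover have "cmod (cinner f e) = cmod (cinner e f)" for e f :: 'a
    by (subst cinner_commute) simp
  ultimately have "((\<lambda>e. (norm (proj E e))\<^sup>2) has_sum card E) B"
    by (simp add: norm_proj_sq[OF E])
  then show ?thesis
    unfolding hs_norm_def Let_def B_def[symmetric] by (simp add: infsumI)
qed

section \<open>Construction of the sequence\<close>

lemma exists_orthonormal_extension_card:
  fixes E :: "'a::complex_inner set"
  assumes step: "\<And>E. finite E \<Longrightarrow> orthonormal E \<Longrightarrow> \<exists>u. norm u = 1 \<and> (\<forall>b\<in>E. cinner u b = 0) \<and> P u"
    and E: "finite E" "orthonormal E"
  shows "\<exists>E'. finite E' \<and> orthonormal E' \<and> E \<subseteq> E' \<and> card (E' - E) = N \<and> (\<forall>u\<in>E' - E. P u)"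
proof (induction N)
  case 0
  then show ?case
    using E by (intro exI[of _ E]) simp
next
  case (Suc N)
  then obtain E' where E': "finite E'" "orthonormal E'" "E \<subseteq> E'" "card (E' - E) = N" "\<forall>u\<in>E' - E. P u"
    by blast
  obtain u where u: "norm u = 1" "\<forall>b\<in>E'. cinner u b = 0" "P u"
    using step[OF E'(1,2)] by blast
  have "cinner u u \<noteq> 0"
    by (simp add: cinner_self u(1))
  then have "u \<notin> E'"
    using u(2) by auto
  moreover from this have "insert u E' - E = insert u (E' - E)"
    using E'(3) by auto
  ultimately show ?case
    using E' u orthonormal_insert[OF E'(2) u(1)] by (intro exI[of _ "insert u E'"]) auto
qed

text \<open>
  Adjoining sufficiently many joint approximate eigenvectors makes the commutator small relative to
  the projection: the contribution of the old part does not depend on their number \<open>N\<close>, whereas the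
  Hilbert-Schmidt norm of the projection is at least \<open>sqrt N\<close>.
\<close>

lemma exists_folner_extension:
  fixes T :: "'a::complex_hilbert_space \<Rightarrow> 'a"
  assumes T: "bounded_clinear T"
    and eig: "\<And>E e. finite E \<Longrightarrow> orthonormal E \<Longrightarrow> e > 0 \<Longrightarrow> \<exists>u. norm u = 1 \<and> (\<forall>b\<in>E. cinner u b = 0)
      \<and> norm (T u - \<mu> *\<^sub>C u) < e \<and> norm (cadjoint T u - cnj \<mu> *\<^sub>C u) < e"
    and E: "finite E" "orthonormal E" and "e > 0"
  shows "\<exists>E'. finite E' \<and> orthonormal E' \<and> E' \<noteq> {} \<and> v \<in> cspan E' \<and>
    hs_bounded (\<lambda>x. T (proj E' x) - proj E' (T x)) (e * sqrt (card E')) \<and> E \<subseteq> E'"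
proof -
  let ?S = "cadjoint T"
  obtain E1 where E1: "finite E1" "orthonormal E1" "E \<subseteq> E1" "v \<in> cspan E1"
    using exists_orthonormal_extension[OF E] by blast
  define M where "M = (\<Sum>f\<in>E1. norm (T f) + norm (?S f))"
  have M: "M \<ge> 0"
    by (simp add: M_def sum_nonneg)
  obtain N0 :: nat where N0: "((M + 1) / e)\<^sup>2 \<le> real N0"
    using real_arch_simple by blast
  define N where "N = Suc N0"
  have N: "N > 0" "((M + 1) / e)\<^sup>2 \<le> real N"
    using N0 by (simp_all add: N_def)
  define h where "h = 1 / (2 * real N)"
  have h: "h > 0"
    using N by (simp add: h_def)
  obtain E2 where E2: "finite E2" "orthonormal E2" "E1 \<subseteq> E2" "card (E2 - E1) = N"
    and small: "\<And>u. u \<in> E2 - E1 \<Longrightarrow> norm (T u - \<mu> *\<^sub>C u) < h \<and> norm (?S u - cnj \<mu> *\<^sub>C u) < h"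
    using exists_orthonormal_extension_card[OF eig[OF _ _ h] E1(1,2), of N] by blast
  \<comment> \<open>Only the newly added vectors are approximate eigenvectors.\<close>
  define \<nu> where "\<nu> = (\<lambda>f. if f \<in> E1 then 0 else \<mu>)"
  define w where "w = (\<lambda>f. norm (T f - \<nu> f *\<^sub>C f) + norm (?S f - cnj (\<nu> f) *\<^sub>C f))"
  have "sum w E2 = sum w E1 + sum w (E2 - E1)"
    using sum.subset_diff[OF E2(3,1), of w] by simp
  also have "sum w E1 = M"
    by (simp add: w_def \<nu>_def M_def)
  also have "sum w (E2 - E1) \<le> (\<Sum>f\<in>E2 - E1. 2 * h)"
  proof (rule sum_mono)
    fix f assume "f \<in> E2 - E1"
    then show "w f \<le> 2 * h"
      using small[of f] by (simp add: w_def \<nu>_def)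
  qed
  also have "\<dots> = 1"
    using N by (simp add: E2(4) h_def)
  finally have "sum w E2 \<le> M + 1"
    by simp
  also have "M + 1 \<le> e * sqrt N"
    using real_le_rsqrt[OF N(2)] \<open>e > 0\<close> by (simp add: pos_divide_le_eq mult.commute)
  also have "\<dots> \<le> e * sqrt (card E2)"
    using \<open>e > 0\<close> card_mono[OF E2(1), of "E2 - E1"] by (simp add: E2(4))
  finally have sum_w: "sum w E2 \<le> e * sqrt (card E2)" .
  have "hs_bounded (\<lambda>x. T (proj E2 x) - proj E2 (T x)) (sum w E2)"
    unfolding w_def by (rule hs_bounded_commutator[OF T cinner_cadjoint[OF T] E2(2)])
  then have "hs_bounded (\<lambda>x. T (proj E2 x) - proj E2 (T x)) (e * sqrt (card E2))"
    using sum_w unfolding hs_bounded_def by (meson order_trans)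
  moreover have "E2 \<noteq> {}"
    using E2(4) N(1) by auto
  moreover have "v \<in> cspan E2"
    using E1(4) complex_vector.span_mono[OF E2(3)] by blast
  ultimately show ?thesis
    using E1(3) E2(1-3) by blast
qed

lemma proper_folner_sequence_proj:
  fixes T :: "'a::complex_hilbert_space \<Rightarrow> 'a" and d :: "nat \<Rightarrow> 'a"
  assumes dense: "closure (range d) = UNIV"
    and E: "\<And>n. finite (E n)" "\<And>n. orthonormal (E n)" "\<And>n. E n \<noteq> {}"
    and mono: "\<And>n. E n \<subseteq> E (Suc n)" and d: "\<And>n. d n \<in> cspan (E n)"
    and hs: "\<And>n. hs_bounded (\<lambda>x. T (proj (E n) x) - proj (E n) (T x)) (1 / Suc n * sqrt (card (E n)))"
  shows "proper_folner_sequence T (\<lambda>n. proj (E n))"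
proof -
  have mono': "E m \<subseteq> E n" if "m \<le> n" for m n
    using lift_Suc_mono_le[of E, OF mono that] .
  have d': "d k \<in> cspan (E n)" if "k \<le> n" for k n
    using d complex_vector.span_mono[OF mono'[OF that]] by blast
  \<comment> \<open>The Hilbert-Schmidt norm refers to a chosen orthonormal basis, so one has to exist.\<close>
  have "orthonormal_basis (\<Union>n. E n)"
    unfolding orthonormal_basis_iff
  proof
    show "orthonormal (\<Union>n. E n)"
      unfolding orthonormal_def
    proof (intro ballI)
      fix a b assume "a \<in> (\<Union>n. E n)" "b \<in> (\<Union>n. E n)"
      then obtain m n where "a \<in> E m" "b \<in> E n"
        by blast
      then have "a \<in> E (max m n)" "b \<in> E (max m n)"
        using mono'[of m "max m n"] mono'[of n "max m n"] by auto
      then show "cinner a b = (if a = b then 1 else 0)"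
        by (rule orthonormalD[OF E(2)])
    qed
    have "range d \<subseteq> cspan (\<Union>n. E n)"
      using d complex_vector.span_mono[of "E _" "\<Union>n. E n"] by blast
    then show "closure (cspan (\<Union>n. E n)) = UNIV"
      using closure_mono dense by blast
  qed
  then have ex: "\<exists>B::'a set. orthonormal_basis B"
    by blast
  have nz: "proj (E n) \<noteq> (\<lambda>x. 0)" for n
  proof -
    obtain e where e: "e \<in> E n"
      using E(3) by blast
    then have "proj (E n) e = e" "norm e = 1"
      using proj_span[OF E(1,2) complex_vector.span_base] orthonormal_norm[OF E(2)] by auto
    then show ?thesis
      by (metis norm_zero zero_neq_one)
  qed
  have ratio: "(\<lambda>n. hs_norm (\<lambda>x. T (proj (E n) x) - proj (E n) (T x)) / hs_norm (proj (E n))) \<longlonglongrightarrow> 0"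
  proof (rule tendsto_sandwich[where f = "\<lambda>_. 0" and h = "\<lambda>n. 1 / Suc n"])
    show "\<forall>\<^sub>F n in sequentially. hs_norm (\<lambda>x. T (proj (E n) x) - proj (E n) (T x)) / hs_norm (proj (E n)) \<le> 1 / Suc n"
    proof (intro always_eventually allI)
      fix n
      have "card (E n) > 0"
        using E(1,3) by (simp add: card_gt_0_iff)
      then show "hs_norm (\<lambda>x. T (proj (E n) x) - proj (E n) (T x)) / hs_norm (proj (E n)) \<le> 1 / Suc n"
        unfolding hs_norm_proj[OF ex E(1,2)]
        using hs_norm_le[OF ex hs[of n]] by (subst pos_divide_le_eq) auto
    qed
    show "(\<lambda>n. 1 / real (Suc n)) \<longlonglongrightarrow> 0"
      using LIMSEQ_Suc[OF lim_1_over_n] by simp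
  qed (simp_all add: hs_norm_nonneg)
  have conv: "(\<lambda>n. proj (E n) x) \<longlonglongrightarrow> x" for x
  proof (rule metric_LIMSEQ_I)
    fix r :: real assume "r > 0"
    then obtain k where k: "dist (d k) x < r"
      using dense closure_approachable[of x "range d"] by auto
    have "dist (proj (E n) x) x < r" if "n \<ge> k" for n
      using proj_best_approx[OF E(1,2) d'[OF that], of x] k by (simp add: dist_norm norm_minus_commute)
    then show "\<exists>n0. \<forall>n\<ge>n0. dist (proj (E n) x) x < r"
      by blast
  qed
  have "range (proj (E m)) \<subseteq> range (proj (E n))" if "m \<le> n" for m n
    unfolding range_proj[OF E(1,2)] by (rule complex_vector.span_mono[OF mono'[OF that]])
  moreover have "finite_rank (proj (E n))" for n
    unfolding finite_rank_def using E(1) range_proj[OF E(1,2)] by blast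
  ultimately show ?thesis
    using orthogonal_projection_proj[OF E(1,2)] nz ratio conv
    by (simp add: proper_folner_sequence_def folner_sequence_def)
qed

lemma proper_folner_sequence_finite_dim:
  fixes T :: "'a::complex_hilbert_space \<Rightarrow> 'a"
  assumes "finite E" "cspan E = (UNIV :: 'a set)" and "\<exists>x::'a. x \<noteq> 0"
  shows "proper_folner_sequence T (\<lambda>n x. x)"
proof -
  have "bounded_clinear (\<lambda>x::'a. x)"
    by (simp add: bounded_clinear_def)
  moreover have "cadjoint (\<lambda>x::'a. x) = (\<lambda>x. x)"
    by (rule cadjoint_eqI) simp
  moreover have "finite_rank (\<lambda>x::'a. x)"
    using assms by (auto simp: finite_rank_def)
  moreover have "hs_norm (\<lambda>x::'a. 0) = 0"
    by (simp add: hs_norm_def Let_def)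
  ultimately show ?thesis
    using assms(3)
    by (simp add: proper_folner_sequence_def folner_sequence_def orthogonal_projection_def o_def fun_eq_iff)
qed

theorem theorem3p5:
  fixes T :: "'a::complex_hilbert_space \<Rightarrow> 'a"
  assumes "separable_space (euclidean :: 'a topology)"
    and "\<exists>x::'a. x \<noteq> 0"
    and "bounded_clinear T"
    and "essentially_normal T"
  shows "\<exists>P. proper_folner_sequence T P"
proof (cases "\<exists>E. finite E \<and> cspan E = (UNIV :: 'a set)")
  case True
  then show ?thesis
    using proper_folner_sequence_finite_dim assms(2) by blast
next
  case False
  then have infdim: "cspan E \<noteq> UNIV" if "finite E" for E :: "'a set"
    using that by blast
  obtain D :: "'a set" where D: "countable D" "closure D = UNIV"
    using assms(1) by (auto simp: separable_space_def)
  define d where "d = from_nat_into D"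
  have "D \<noteq> {}"
    using D(2) by auto
  then have dense: "closure (range d) = UNIV"
    using D by (simp add: d_def)
  obtain \<mu> and x :: "nat \<Rightarrow> 'a" where x: "weakly_null x" "\<And>n. norm (x n) = 1"
    "(\<lambda>n. T (x n) - \<mu> *\<^sub>C x n) \<longlonglongrightarrow> 0" "(\<lambda>n. cadjoint T (x n) - cnj \<mu> *\<^sub>C x n) \<longlonglongrightarrow> 0"
    using essentially_normal_approximate_eigenvectors[OF assms(3,4) dense] infdim by metis
  note eig = exists_orthogonal_approximate_eigenvector[OF assms(3) bounded_clinear_cadjoint[OF assms(3)] x]
  define Q where "Q = (\<lambda>n E. finite E \<and> orthonormal E \<and> E \<noteq> {} \<and> d n \<in> cspan E \<and>
    hs_bounded (\<lambda>x. T (proj E x) - proj E (T x)) (1 / Suc n * sqrt (card E)))"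
  have step: "\<exists>E'. Q n E' \<and> E \<subseteq> E'" if "finite E" "orthonormal E" for n E
    unfolding Q_def conj_assoc
    by (rule exists_folner_extension[OF assms(3) eig]) (use that in simp_all)
  have "\<exists>E. \<forall>n. Q n (E n) \<and> E n \<subseteq> E (Suc n)"
  proof (rule dependent_nat_choice)
    show "\<exists>E. Q 0 E"
      using step[of "{}"] by (auto simp: orthonormal_def)
    show "\<exists>E'. Q (Suc n) E' \<and> E \<subseteq> E'" if "Q n E" for E n
      using that step unfolding Q_def by blast
  qed
  then obtain E where "\<And>n. Q n (E n)" "\<And>n. E n \<subseteq> E (Suc n)"
    by blast
  then show ?thesis
    using proper_folner_sequence_proj[OF dense, of E T] unfolding Q_def by blast
qed

end
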